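(* Let $(\boldsymbol{J}_h,\phi_h,\boldsymbol{A}_h,r_h)\in \mathbf{D}_h\times \mathrm{S}_h\times\mathbf{C}_h\times \mathrm{R}_h$ be a solution of the following discrete problem: for all $(\boldsymbol{\varphi}_h,\psi_h,\boldsymbol{a}_h,s_h)\in \mathbf{D}_h\times \mathrm{S}_h\times\mathbf{C}_h\times \mathrm{R}_h$, $$\eta(\boldsymbol{J}_h,\boldsymbol{\varphi}_h)-(\phi_h,\operatorname{div}\boldsymbol{\varphi}_h)-(\boldsymbol{w}\times\operatorname{\mathbf{curl}}\boldsymbol{A}_h,\boldsymbol{\varphi}_h)=(\boldsymbol{f},\boldsymbol{\varphi}_h),$$ $$-(\operatorname{div}\boldsymbol{J}_h,\psi_h)=0,$$ $$-(\boldsymbol{J}_h,\boldsymbol{a}_h)+\nu_m(\operatorname{\mathbf{curl}}\boldsymbol{A}_h,\operatorname{\mathbf{curl}}\boldsymbol{a}_h)+(\nabla r_h,\boldsymbol{a}_h)=(\boldsymbol{g},\boldsymbol{a}_h),$$ $$(\boldsymbol{A}_h,\nabla s_h)=0.$$ Set $\boldsymbol{B}_h:=\operatorname{\mathbf{curl}}\boldsymbol{A}_h$. Then, because $\operatorname{div}\mathbf{D}_h\subseteq \mathrm{S}_h$ and $\boldsymbol{B}_h=\operatorname{\mathbf{curl}}\boldsymbol{A}_h$, $$\operatorname{div}\boldsymbol{J}_h=0\quad\text{and}\quad \operatorname{div}\boldsymbol{B}_h=0\qquad\text{in }\Omega .$$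
   Context: $\Omega\subset\mathbb{R}^3$ is a bounded, simply-connected Lipschitz polyhedral domain with boundary $\Gamma=\partial\Omega$ and unit outer normal $\boldsymbol{n}$. $(\cdot,\cdot)$ is the $L^2(\Omega)$ (or $L^2(\Omega)^3$) inner product. $\eta=\sigma^{-1}$ is the electrical resistivity ($\sigma$ the dimensionless conductivity) and $\nu_m=\mathsf{Rm}^{-1}$ is the inverse of the magnetic Reynolds number $\mathsf{Rm}$; $\boldsymbol{w}$ is a given (known) velocity field, not necessarily divergence-free; $\boldsymbol{f},\boldsymbol{g}$ are given source terms. Function spaces: $\boldsymbol{H}(\operatorname{div},\Omega)=\{\boldsymbol{v}\in L^2(\Omega)^3:\operatorname{div}\boldsymbol{v}\in L^2(\Omega)\}$; $\boldsymbol{H}_0(\operatorname{\mathbf{curl}},\Omega)=\{\boldsymbol{v}\in L^2(\Omega)^3:\operatorname{\mathbf{curl}}\boldsymbol{v}\in L^2(\Omega)^3,\ \boldsymbol{n}\times\boldsymbol{v}=0\text{ on }\Gamma\}$; $H_0^1(\Omega)$ is the space of $H^1(\Omega)$ functions with zero trace on $\Gamma$. $\mathcal{T}_h$ is a shape-regular tetrahedral triangulation of $\Omega$. For $K\in\mathcal{T}_h$, $P_k(K)$ denotes polynomials of total degree at most $k$ on $K$ and $\boldsymbol{P}_1(K)=P_1(K)^3$. The finite element spaces are $$\mathbf{D}_h=\{\boldsymbol{\varphi}_h\in\boldsymbol{H}(\operatorname{div},\Omega):\boldsymbol{\varphi}_h|_K\in\boldsymbol{P}_1(K)\ \forall K\in\mathcal{T}_h\},\quad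 \mathrm{S}_h=\{\psi_h\in L^2(\Omega):\psi_h|_K\in P_0(K)\ \forall K\in\mathcal{T}_h\},$$ $$\mathbf{C}_h=\{\boldsymbol{a}_h\in\boldsymbol{H}_0(\operatorname{\mathbf{curl}},\Omega):\boldsymbol{a}_h|_K\in\boldsymbol{P}_1(K)\ \forall K\in\mathcal{T}_h\},\quad \mathrm{R}_h=\{s_h\in H^1_0(\Omega):s_h|_K\in P_2(K)\ \forall K\in\mathcal{T}_h\}.$$ *)

theory Defs
  imports "HOL-Analysis.Analysis"
begin

unbundle cross3_syntax

section \<open>Polyhedral domains and their boundary\<close>

text \<open>Near every boundary point, in suitable Cartesian coordinates, the set is the strict epigraph
  of a Lipschitz function of the first two coordinates.\<close>

definition lipschitz_boundary :: "(real^3) set \<Rightarrow> bool" where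
  "lipschitz_boundary \<Omega> \<longleftrightarrow>
     (\<forall>p\<in>frontier \<Omega>. \<exists>(T :: real^3 \<Rightarrow> real^3) (r :: real) (L :: real) (\<gamma> :: real^2 \<Rightarrow> real).
        orthogonal_transformation T \<and> r > 0 \<and> L-lipschitz_on UNIV \<gamma> \<and>
        (\<forall>y\<in>ball p r. y \<in> \<Omega> \<longleftrightarrow> \<gamma> (vector [T y $ 1, T y $ 2]) < T y $ 3))"

definition polyhedral :: "(real^3) set \<Rightarrow> bool" where
  "polyhedral \<Omega> \<longleftrightarrow> (\<exists>F. finite F \<and> (\<forall>P\<in>F. polytope P) \<and> closure \<Omega> = \<Union>F)"

definition lipschitz_polyhedral_domain :: "(real^3) set \<Rightarrow> bool" where
  "lipschitz_polyhedral_domain \<Omega> \<longleftrightarrow>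
     open \<Omega> \<and> connected \<Omega> \<and> \<Omega> \<noteq> {} \<and> polyhedral \<Omega> \<and> lipschitz_boundary \<Omega>"

text \<open>The surface measure is the two-dimensional Hausdorff measure; the factor \<open>pi / 4\<close> makes it
  agree with area on planar sets.\<close>

definition hausdorff2 :: "(real^3) set \<Rightarrow> ennreal" where
  "hausdorff2 A =
     (SUP \<delta>\<in>{0<..}. INF U\<in>{U :: nat \<Rightarrow> (real^3) set.
          A \<subseteq> (\<Union>i. U i) \<and> (\<forall>i. bounded (U i) \<and> diameter (U i) \<le> \<delta>)}.
        (\<Sum>i. ennreal (pi / 4 * (diameter (U i))\<^sup>2)))"

definition surface_measure :: "(real^3) set \<Rightarrow> (real^3) measure" where
  "surface_measure \<Gamma> = restrict_space (measure_of UNIV (sets borel) hausdorff2) \<Gamma>"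

text \<open>The outer unit normal of a polyhedral domain exists in the relative interior of the boundary
  faces, where the domain is locally a half space. On edges and vertices, a set of surface measure
  zero, the value is set to 0.\<close>

definition is_outer_normal :: "(real^3) set \<Rightarrow> real^3 \<Rightarrow> real^3 \<Rightarrow> bool" where
  "is_outer_normal \<Omega> x \<nu> \<longleftrightarrow>
     norm \<nu> = 1 \<and> (\<exists>r>0. \<Omega> \<inter> ball x r = {y \<in> ball x r. (y - x) \<bullet> \<nu> < 0})"

definition outer_normal :: "(real^3) set \<Rightarrow> real^3 \<Rightarrow> real^3" where
  "outer_normal \<Omega> x =
     (if \<exists>\<nu>. is_outer_normal \<Omega> x \<nu> then THE \<nu>. is_outer_normal \<Omega> x \<nu> else 0)"


section \<open>Smooth fields and classical differential operators\<close>

definition pdiff :: "3 \<Rightarrow> (real^3 \<Rightarrow> real) \<Rightarrow> real^3 \<Rightarrow> real" where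
  "pdiff i f x = frechet_derivative f (at x) (axis i 1)"

primrec Ck :: "nat \<Rightarrow> (real^3 \<Rightarrow> real) \<Rightarrow> bool" where
  "Ck 0 f \<longleftrightarrow> continuous_on UNIV f"
| "Ck (Suc k) f \<longleftrightarrow> (\<forall>x. f differentiable (at x)) \<and> (\<forall>i. Ck k (pdiff i f))"

definition smooth :: "(real^3 \<Rightarrow> real) \<Rightarrow> bool" where
  "smooth f \<longleftrightarrow> (\<forall>k. Ck k f)"

definition smooth_field :: "(real^3 \<Rightarrow> real^3) \<Rightarrow> bool" where
  "smooth_field v \<longleftrightarrow> (\<forall>i. smooth (\<lambda>x. v x $ i))"

definition test_function :: "(real^3) set \<Rightarrow> (real^3 \<Rightarrow> real) \<Rightarrow> bool" where
  "test_function \<Omega> \<phi> \<longleftrightarrow>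
     smooth \<phi> \<and> compact (closure {x. \<phi> x \<noteq> 0}) \<and> closure {x. \<phi> x \<noteq> 0} \<subseteq> \<Omega>"

definition test_field :: "(real^3) set \<Rightarrow> (real^3 \<Rightarrow> real^3) \<Rightarrow> bool" where
  "test_field \<Omega> v \<longleftrightarrow> (\<forall>i. test_function \<Omega> (\<lambda>x. v x $ i))"

definition grad :: "(real^3 \<Rightarrow> real) \<Rightarrow> real^3 \<Rightarrow> real^3" where
  "grad f x = (\<chi> i. pdiff i f x)"

definition divg :: "(real^3 \<Rightarrow> real^3) \<Rightarrow> real^3 \<Rightarrow> real" where
  "divg v x = (\<Sum>i\<in>UNIV. pdiff i (\<lambda>y. v y $ i) x)"

definition curl :: "(real^3 \<Rightarrow> real^3) \<Rightarrow> real^3 \<Rightarrow> real^3" where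
  "curl v x = vector
     [pdiff 2 (\<lambda>y. v y $ 3) x - pdiff 3 (\<lambda>y. v y $ 2) x,
      pdiff 3 (\<lambda>y. v y $ 1) x - pdiff 1 (\<lambda>y. v y $ 3) x,
      pdiff 1 (\<lambda>y. v y $ 2) x - pdiff 2 (\<lambda>y. v y $ 1) x]"


section \<open>Lebesgue and Sobolev spaces\<close>

text \<open>Elements of the spaces are represented by functions on the whole space of which only the
  values almost everywhere in \<open>\<Omega>\<close> matter.\<close>

definition L2 :: "(real^3) set \<Rightarrow> (real^3 \<Rightarrow> 'b::euclidean_space) set" where
  "L2 \<Omega> = {u. u \<in> borel_measurable (lebesgue_on \<Omega>) \<and>
              integrable (lebesgue_on \<Omega>) (\<lambda>x. (norm (u x))\<^sup>2)}"

definition L2_inner ::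
  "(real^3) set \<Rightarrow> (real^3 \<Rightarrow> 'b::euclidean_space) \<Rightarrow> (real^3 \<Rightarrow> 'b) \<Rightarrow> real" where
  "L2_inner \<Omega> u v = (\<integral>x. u x \<bullet> v x \<partial>lebesgue_on \<Omega>)"

definition L2_norm :: "(real^3) set \<Rightarrow> (real^3 \<Rightarrow> 'b::euclidean_space) \<Rightarrow> real" where
  "L2_norm \<Omega> u = sqrt (L2_inner \<Omega> u u)"

definition has_weak_grad :: "(real^3) set \<Rightarrow> (real^3 \<Rightarrow> real) \<Rightarrow> (real^3 \<Rightarrow> real^3) \<Rightarrow> bool" where
  "has_weak_grad \<Omega> u g \<longleftrightarrow> u \<in> L2 \<Omega> \<and> g \<in> L2 \<Omega> \<and>
     (\<forall>v. test_field \<Omega> v \<longrightarrow> L2_inner \<Omega> u (divg v) = - L2_inner \<Omega> g v)"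

definition has_weak_div :: "(real^3) set \<Rightarrow> (real^3 \<Rightarrow> real^3) \<Rightarrow> (real^3 \<Rightarrow> real) \<Rightarrow> bool" where
  "has_weak_div \<Omega> v d \<longleftrightarrow> v \<in> L2 \<Omega> \<and> d \<in> L2 \<Omega> \<and>
     (\<forall>\<phi>. test_function \<Omega> \<phi> \<longrightarrow> L2_inner \<Omega> v (grad \<phi>) = - L2_inner \<Omega> d \<phi>)"

definition has_weak_curl :: "(real^3) set \<Rightarrow> (real^3 \<Rightarrow> real^3) \<Rightarrow> (real^3 \<Rightarrow> real^3) \<Rightarrow> bool" where
  "has_weak_curl \<Omega> v c \<longleftrightarrow> v \<in> L2 \<Omega> \<and> c \<in> L2 \<Omega> \<and>
     (\<forall>\<phi>. test_field \<Omega> \<phi> \<longrightarrow> L2_inner \<Omega> v (curl \<phi>) = L2_inner \<Omega> c \<phi>)"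

text \<open>Weak derivatives are unique up to null sets; a representative is chosen.\<close>

definition weak_grad :: "(real^3) set \<Rightarrow> (real^3 \<Rightarrow> real) \<Rightarrow> real^3 \<Rightarrow> real^3" where
  "weak_grad \<Omega> u = (SOME g. has_weak_grad \<Omega> u g)"

definition weak_div :: "(real^3) set \<Rightarrow> (real^3 \<Rightarrow> real^3) \<Rightarrow> real^3 \<Rightarrow> real" where
  "weak_div \<Omega> v = (SOME d. has_weak_div \<Omega> v d)"

definition weak_curl :: "(real^3) set \<Rightarrow> (real^3 \<Rightarrow> real^3) \<Rightarrow> real^3 \<Rightarrow> real^3" where
  "weak_curl \<Omega> v = (SOME c. has_weak_curl \<Omega> v c)"

definition H1 :: "(real^3) set \<Rightarrow> (real^3 \<Rightarrow> real) set" where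
  "H1 \<Omega> = {u. \<exists>g. has_weak_grad \<Omega> u g}"

definition Hdiv :: "(real^3) set \<Rightarrow> (real^3 \<Rightarrow> real^3) set" where
  "Hdiv \<Omega> = {v. \<exists>d. has_weak_div \<Omega> v d}"

definition Hcurl :: "(real^3) set \<Rightarrow> (real^3 \<Rightarrow> real^3) set" where
  "Hcurl \<Omega> = {v. \<exists>c. has_weak_curl \<Omega> v c}"

text \<open>The traces \<open>u\<close> and \<open>n \<times> v\<close> on the boundary are the continuous extensions, with values in
  \<open>L\<^sup>2(\<Gamma>)\<close> and in the dual space \<open>H\<^sup>-\<^sup>1\<^sup>/\<^sup>2(\<Gamma>)\<^sup>3\<close> respectively, of the classical traces of functions
  that are smooth up to the boundary. The latter is tested weakly: by Green's formula, convergence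
  in \<open>Hcurl\<close> makes the boundary integrals converge to the value of the trace functional at \<open>\<phi>\<close>, and
  the traces of smooth \<open>\<phi>\<close> are dense in \<open>H\<^sup>1\<^sup>/\<^sup>2(\<Gamma>)\<^sup>3\<close>.\<close>

definition zero_trace :: "(real^3) set \<Rightarrow> (real^3 \<Rightarrow> real) \<Rightarrow> bool" where
  "zero_trace \<Omega> u \<longleftrightarrow> (\<exists>U :: nat \<Rightarrow> real^3 \<Rightarrow> real.
     (\<forall>k. smooth (U k)) \<and>
     (\<lambda>k. L2_norm \<Omega> (\<lambda>x. U k x - u x)) \<longlonglongrightarrow> 0 \<and>
     (\<lambda>k. L2_norm \<Omega> (\<lambda>x. grad (U k) x - weak_grad \<Omega> u x)) \<longlonglongrightarrow> 0 \<and>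
     (\<lambda>k. \<integral>x. (U k x)\<^sup>2 \<partial>surface_measure (frontier \<Omega>)) \<longlonglongrightarrow> 0)"

definition zero_tangential_trace :: "(real^3) set \<Rightarrow> (real^3 \<Rightarrow> real^3) \<Rightarrow> bool" where
  "zero_tangential_trace \<Omega> v \<longleftrightarrow> (\<exists>V :: nat \<Rightarrow> real^3 \<Rightarrow> real^3.
     (\<forall>k. smooth_field (V k)) \<and>
     (\<lambda>k. L2_norm \<Omega> (\<lambda>x. V k x - v x)) \<longlonglongrightarrow> 0 \<and>
     (\<lambda>k. L2_norm \<Omega> (\<lambda>x. curl (V k) x - weak_curl \<Omega> v x)) \<longlonglongrightarrow> 0 \<and>
     (\<forall>\<phi>. smooth_field \<phi> \<longrightarrow>
        (\<lambda>k. \<integral>x. (outer_normal \<Omega> x \<times> V k x) \<bullet> \<phi> x \<partial>surface_measure (frontier \<Omega>)) \<longlonglongrightarrow> 0))"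

definition H1_0 :: "(real^3) set \<Rightarrow> (real^3 \<Rightarrow> real) set" where
  "H1_0 \<Omega> = {u \<in> H1 \<Omega>. zero_trace \<Omega> u}"

definition Hcurl_0 :: "(real^3) set \<Rightarrow> (real^3 \<Rightarrow> real^3) set" where
  "Hcurl_0 \<Omega> = {v \<in> Hcurl \<Omega>. zero_tangential_trace \<Omega> v}"


section \<open>Triangulations and finite element spaces\<close>

definition tetrahedral_triangulation :: "(real^3) set set \<Rightarrow> (real^3) set \<Rightarrow> bool" where
  "tetrahedral_triangulation \<T> \<Omega> \<longleftrightarrow>
     triangulation \<T> \<and> (\<forall>K\<in>\<T>. 3 simplex K) \<and> \<Union>\<T> = closure \<Omega>"

definition inradius :: "(real^3) set \<Rightarrow> real" where
  "inradius K = Sup {r. r \<ge> 0 \<and> (\<exists>c. cball c r \<subseteq> K)}"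

definition shape_regular :: "real \<Rightarrow> (real^3) set set \<Rightarrow> bool" where
  "shape_regular \<kappa> \<T> \<longleftrightarrow> (\<forall>K\<in>\<T>. diameter K \<le> \<kappa> * inradius K)"

definition poly_deg_le :: "nat \<Rightarrow> (real^3 \<Rightarrow> real) \<Rightarrow> bool" where
  "poly_deg_le k p \<longleftrightarrow> (\<exists>c :: nat^3 \<Rightarrow> real.
     p = (\<lambda>x. \<Sum>\<alpha>\<in>{\<alpha>. (\<Sum>i\<in>UNIV. \<alpha> $ i) \<le> k}. c \<alpha> * (\<Prod>i\<in>UNIV. x $ i ^ (\<alpha> $ i))))"

definition P_on :: "nat \<Rightarrow> (real^3) set \<Rightarrow> (real^3 \<Rightarrow> real) set" where
  "P_on k K = {u. \<exists>p. poly_deg_le k p \<and> (AE x in lebesgue_on K. u x = p x)}"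

definition P_vec_on :: "nat \<Rightarrow> (real^3) set \<Rightarrow> (real^3 \<Rightarrow> real^3) set" where
  "P_vec_on k K = {v. \<forall>i. (\<lambda>x. v x $ i) \<in> P_on k K}"

definition D_space :: "(real^3) set \<Rightarrow> (real^3) set set \<Rightarrow> (real^3 \<Rightarrow> real^3) set" where
  "D_space \<Omega> \<T> = {\<phi> \<in> Hdiv \<Omega>. \<forall>K\<in>\<T>. \<phi> \<in> P_vec_on 1 K}"

definition S_space :: "(real^3) set \<Rightarrow> (real^3) set set \<Rightarrow> (real^3 \<Rightarrow> real) set" where
  "S_space \<Omega> \<T> = {\<psi> \<in> L2 \<Omega>. \<forall>K\<in>\<T>. \<psi> \<in> P_on 0 K}"

definition C_space :: "(real^3) set \<Rightarrow> (real^3) set set \<Rightarrow> (real^3 \<Rightarrow> real^3) set" where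
  "C_space \<Omega> \<T> = {a \<in> Hcurl_0 \<Omega>. \<forall>K\<in>\<T>. a \<in> P_vec_on 1 K}"

definition R_space :: "(real^3) set \<Rightarrow> (real^3) set set \<Rightarrow> (real^3 \<Rightarrow> real) set" where
  "R_space \<Omega> \<T> = {s \<in> H1_0 \<Omega>. \<forall>K\<in>\<T>. s \<in> P_on 2 K}"

end

theory Submission
  imports Defs
begin

text \<open>The weak divergence of a field that is smooth on an open set \<open>U\<close> agrees almost everywhere on
  \<open>U\<close> with the classical one, by integration by parts and the fundamental lemma of the calculus of
  variations. On each simplex \<open>J\<close> is affine, so its divergence is constant there; hence the
  divergence is itself an admissible test function in the second discrete equation, and its
  \<open>L\<^sup>2\<close> norm vanishes. For \<open>B\<close>, the identity \<open>curl (grad \<phi>) = 0\<close> shows that 0 is a weak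
  divergence, and weak divergences are unique almost everywhere.\<close>

section \<open>Partial derivatives\<close>

text \<open>A weak divergence is only an arbitrarily chosen \<open>L2\<close> representative, so
  even its constancy on a simplex has to be recovered from its action on test functions. Test
  functions supported in the interior of a single simplex do not see jumps across faces; the
  compatibility of the pieces is already contained in membership in \<open>Hdiv\<close>. The
  fundamental lemma is reached without mollification: explicit smooth bumps converge to indicators
  of boxes, and boxes form an intersection-stable generator of the Borel sets. Since
  \<open>smooth\<close> is defined through iterated \<open>pdiff\<close>, the bumps and the symmetry
  of mixed derivatives are both obtained in terms of \<open>pdiff\<close>.\<close>

lemma pdiff_eqI: "(f has_derivative f') (at x) \<Longrightarrow> pdiff i f x = f' (axis i 1)"
  unfolding pdiff_def using frechet_derivative_at by metis

text \<open>Restriction to a coordinate line makes the one-variable mean value theorem available for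
  partial derivatives.\<close>

lemma has_real_derivative_along_axis:
  assumes "f differentiable (at (x + t *\<^sub>R axis i 1))"
  shows "((\<lambda>s. f (x + s *\<^sub>R axis i 1)) has_real_derivative pdiff i f (x + t *\<^sub>R axis i 1)) (at t)"
proof -
  let ?D = "frechet_derivative f (at (x + t *\<^sub>R axis i 1))"
  have D: "(f has_derivative ?D) (at (x + t *\<^sub>R axis i 1))"
    using assms frechet_derivative_works by blast
  have "((\<lambda>s. x + s *\<^sub>R axis i 1) has_derivative (\<lambda>s. s *\<^sub>R axis i 1)) (at t)"
    by (auto intro!: derivative_eq_intros)
  from has_derivative_compose[OF this D]
  have "((\<lambda>s. f (x + s *\<^sub>R axis i 1)) has_derivative (\<lambda>s. ?D (s *\<^sub>R axis i 1))) (at t)" .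
  moreover have "?D (s *\<^sub>R axis i 1) = s * pdiff i f (x + t *\<^sub>R axis i 1)" for s
    using linear_scale[OF has_derivative_linear[OF D]] by (simp add: pdiff_def)
  ultimately show ?thesis by (simp add: has_field_derivative_def mult.commute[of _ "pdiff _ _ _"])
qed

lemma pdiff_const [simp]: "pdiff i (\<lambda>x. c) = (\<lambda>x. 0)"
  by (rule ext, subst pdiff_eqI[OF has_derivative_const]) simp

lemma pdiff_mult:
  assumes "f differentiable (at x)" "g differentiable (at x)"
  shows "pdiff i (\<lambda>x. f x * g x) x = f x * pdiff i g x + pdiff i f x * g x"
  using has_derivative_mult[OF assms[unfolded frechet_derivative_works]]
  by (subst pdiff_eqI) (auto simp: pdiff_def)

lemma pdiff_add:
  assumes "f differentiable (at x)" "g differentiable (at x)"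
  shows "pdiff i (\<lambda>x. f x + g x) x = pdiff i f x + pdiff i g x"
  using has_derivative_add[OF assms[unfolded frechet_derivative_works]]
  by (subst pdiff_eqI) (auto simp: pdiff_def)

section \<open>Closure properties of the classes \<open>Ck\<close>\<close>

lemma Ck_SucD: "Ck (Suc k) f \<Longrightarrow> Ck k f"
proof (induction k arbitrary: f)
  case 0
  then show ?case
    by (auto intro!: continuous_at_imp_continuous_on differentiable_imp_continuous_within)
qed auto

lemma Ck_continuous: "Ck k f \<Longrightarrow> continuous_on UNIV f"
proof (induction k)
  case (Suc k)
  then show ?case using Ck_SucD by blast
qed auto

lemma Ck_const: "Ck k (\<lambda>x. c)"
  by (induction k arbitrary: c) (auto)

lemma Ck_add: "Ck k f \<Longrightarrow> Ck k g \<Longrightarrow> Ck k (\<lambda>x. f x + g x)"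
proof (induction k arbitrary: f g)
  case 0
  then show ?case by (auto intro: continuous_intros)
next
  case (Suc k)
  then have "pdiff i (\<lambda>x. f x + g x) = (\<lambda>x. pdiff i f x + pdiff i g x)" for i
    by (auto simp: pdiff_add)
  with Suc show ?case by (auto)
qed

text \<open>The product rule leaves one factor undifferentiated in each term, so the induction also
  needs both factors one order lower, which \<open>Ck_SucD\<close> supplies.\<close>

lemma Ck_mult: "Ck k f \<Longrightarrow> Ck k g \<Longrightarrow> Ck k (\<lambda>x. f x * g x)"
proof (induction k arbitrary: f g)
  case 0
  then show ?case by (auto intro: continuous_intros)
next
  case (Suc k)
  then have "pdiff i (\<lambda>x. f x * g x) = (\<lambda>x. f x * pdiff i g x + pdiff i f x * g x)" for i
    by (auto simp: pdiff_mult)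
  moreover have "Ck k f" "Ck k g" using Suc.prems Ck_SucD by blast+
  ultimately show ?case using Suc by (auto intro!: Ck_add)
qed

lemma smooth_pdiff: "smooth f \<Longrightarrow> smooth (pdiff i f)"
  unfolding smooth_def by (metis Ck.simps(2))

lemma smooth_differentiable: "smooth f \<Longrightarrow> f differentiable (at x)"
  unfolding smooth_def by (metis Ck.simps(2))

lemma smooth_continuous: "smooth f \<Longrightarrow> continuous_on UNIV f"
  unfolding smooth_def by (metis Ck.simps(1))

section \<open>Supports of derivatives, and test functions\<close>

lemma pdiff_eq_0_outside_support:
  assumes "x \<notin> closure {x. f x \<noteq> 0}"
  shows "pdiff i f x = 0"
proof -
  have "((\<lambda>x. 0) has_derivative (\<lambda>x. 0)) (at x)" by simp
  then have "(f has_derivative (\<lambda>x. 0)) (at x)"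
    by (rule has_derivative_transform_within_open[of _ _ _ _ "- closure {x. f x \<noteq> 0}"])
      (use assms closure_subset[of "{x. f x \<noteq> 0}"] in auto)
  then show ?thesis by (subst pdiff_eqI) auto
qed

lemma support_pdiff: "closure {x. pdiff i f x \<noteq> 0} \<subseteq> closure {x. f x \<noteq> 0}"
  using pdiff_eq_0_outside_support by (intro closure_minimal) auto

lemma test_function_pdiff: "test_function \<Omega> f \<Longrightarrow> test_function \<Omega> (pdiff i f)"
  unfolding test_function_def using smooth_pdiff support_pdiff[of i f]
  by (meson closed_closure compact_closure bounded_subset compact_imp_bounded order_trans closure_subset)

lemma test_function_mono: "test_function U f \<Longrightarrow> U \<subseteq> V \<Longrightarrow> test_function V f"
  by (auto simp: test_function_def)

text \<open>The left-hand side is symmetric in \<open>i\<close> and \<open>j\<close>, the right-hand side tends to the mixed second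
  derivative after division by \<open>h\<^sup>2\<close>.\<close>

lemma second_difference_mean_value:
  assumes "Ck 2 f" "h > 0"
  obtains s t where "0 < s" "s < h" "0 < t" "t < h"
    "f (x + h *\<^sub>R axis i 1 + h *\<^sub>R axis j 1) - f (x + h *\<^sub>R axis i 1) - f (x + h *\<^sub>R axis j 1) + f x
      = h * h * pdiff j (pdiff i f) (x + s *\<^sub>R axis i 1 + t *\<^sub>R axis j 1)"
proof -
  have d: "f differentiable (at y)" "pdiff i f differentiable (at y)" for y
    using assms by (auto simp: numeral_2_eq_2)
  \<comment> \<open>\<open>G\<close> is the increment in direction \<open>j\<close>, viewed as a
    function of the displacement in direction \<open>i\<close>. One mean value theorem for
    \<open>G\<close> and a second one in direction \<open>j\<close> give the two factors
    \<open>h\<close>.\<close>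
  define G where "G s = f (x + h *\<^sub>R axis j 1 + s *\<^sub>R axis i 1) - f (x + s *\<^sub>R axis i 1)" for s
  have "\<exists>s. 0 < s \<and> s < h \<and> G h - G 0
      = (h - 0) * (pdiff i f (x + h *\<^sub>R axis j 1 + s *\<^sub>R axis i 1) - pdiff i f (x + s *\<^sub>R axis i 1))"
    unfolding G_def using d(1)
    by (intro MVT2[OF \<open>h > 0\<close>] DERIV_diff has_real_derivative_along_axis)
  then obtain s where s: "0 < s" "s < h" "G h - G 0
      = h * (pdiff i f (x + s *\<^sub>R axis i 1 + h *\<^sub>R axis j 1) - pdiff i f (x + s *\<^sub>R axis i 1 + 0 *\<^sub>R axis j 1))"
    by (auto simp: algebra_simps)
  have "\<exists>t. 0 < t \<and> t < h \<and>
      pdiff i f (x + s *\<^sub>R axis i 1 + h *\<^sub>R axis j 1) - pdiff i f (x + s *\<^sub>R axis i 1 + 0 *\<^sub>R axis j 1)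
      = (h - 0) * pdiff j (pdiff i f) (x + s *\<^sub>R axis i 1 + t *\<^sub>R axis j 1)"
    using d(2) by (intro MVT2[OF \<open>h > 0\<close>] has_real_derivative_along_axis)
  then obtain t where t: "0 < t" "t < h"
      "pdiff i f (x + s *\<^sub>R axis i 1 + h *\<^sub>R axis j 1) - pdiff i f (x + s *\<^sub>R axis i 1 + 0 *\<^sub>R axis j 1)
      = h * pdiff j (pdiff i f) (x + s *\<^sub>R axis i 1 + t *\<^sub>R axis j 1)"
    by auto
  have "G h - G 0 = f (x + h *\<^sub>R axis i 1 + h *\<^sub>R axis j 1) - f (x + h *\<^sub>R axis i 1) - f (x + h *\<^sub>R axis j 1) + f x"
    by (simp add: G_def add_ac)
  then show ?thesis using s t by (intro that[of s t]) auto
qed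

text \<open>Evaluating the second difference in both orders yields two points near \<open>x\<close>
  at which the two mixed derivatives take the same value; continuity then excludes a gap at
  \<open>x\<close>. The number \<open>e\<close> is half the supposed gap, so two errors below
  \<open>e\<close> cannot bridge it.\<close>

lemma pdiff_commute:
  assumes "Ck 2 f"
  shows "pdiff i (pdiff j f) x = pdiff j (pdiff i f) x"
proof (rule ccontr)
  assume neq: "pdiff i (pdiff j f) x \<noteq> pdiff j (pdiff i f) x"
  define e where "e = \<bar>pdiff i (pdiff j f) x - pdiff j (pdiff i f) x\<bar> / 2"
  have "e > 0" using neq by (auto simp: e_def)
  have c: "isCont (pdiff i (pdiff j f)) x" "isCont (pdiff j (pdiff i f)) x"
    using assms by (auto simp: numeral_2_eq_2 continuous_on_eq_continuous_at)
  obtain d1 where d1: "d1 > 0" "\<And>y. dist y x < d1 \<Longrightarrow> dist (pdiff i (pdiff j f) y) (pdiff i (pdiff j f) x) < e"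
    using c(1) \<open>e > 0\<close> by (metis continuous_at_eps_delta)
  obtain d2 where d2: "d2 > 0" "\<And>y. dist y x < d2 \<Longrightarrow> dist (pdiff j (pdiff i f) y) (pdiff j (pdiff i f) x) < e"
    using c(2) \<open>e > 0\<close> by (metis continuous_at_eps_delta)
  \<comment> \<open>Each intermediate point is reached by two displacements shorter than
    \<open>h\<close>, hence lies within \<open>2 * h\<close> of \<open>x\<close>; the factor 1/2
    keeps it inside both radii.\<close>
  define h where "h = min d1 d2 / 2"
  have h: "h > 0" "2 * h \<le> d1" "2 * h \<le> d2" using d1 d2 by (auto simp: h_def)
  have n: "norm (s *\<^sub>R axis k 1 + t *\<^sub>R axis l 1 :: real^3) < 2 * h" if "0 < s" "s < h" "0 < t" "t < h" for s t k l
    using norm_triangle_ineq[of "s *\<^sub>R axis k 1" "t *\<^sub>R axis l (1::real) :: real^3"] that by (simp add: norm_axis_1)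
  obtain s t where st: "0 < s" "s < h" "0 < t" "t < h"
    "f (x + h *\<^sub>R axis i 1 + h *\<^sub>R axis j 1) - f (x + h *\<^sub>R axis i 1) - f (x + h *\<^sub>R axis j 1) + f x
      = h * h * pdiff j (pdiff i f) (x + s *\<^sub>R axis i 1 + t *\<^sub>R axis j 1)"
    using second_difference_mean_value[OF assms h(1)] by blast
  obtain s' t' where st': "0 < s'" "s' < h" "0 < t'" "t' < h"
    "f (x + h *\<^sub>R axis j 1 + h *\<^sub>R axis i 1) - f (x + h *\<^sub>R axis j 1) - f (x + h *\<^sub>R axis i 1) + f x
      = h * h * pdiff i (pdiff j f) (x + s' *\<^sub>R axis j 1 + t' *\<^sub>R axis i 1)"
    using second_difference_mean_value[OF assms h(1)] by blast
  have "pdiff j (pdiff i f) (x + s *\<^sub>R axis i 1 + t *\<^sub>R axis j 1)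
      = pdiff i (pdiff j f) (x + s' *\<^sub>R axis j 1 + t' *\<^sub>R axis i 1)"
  proof -
    have comm: "x + h *\<^sub>R axis j 1 + h *\<^sub>R axis i 1 = x + h *\<^sub>R axis i 1 + h *\<^sub>R axis j 1"
      by (simp add: add_ac)
    have "h * h * pdiff j (pdiff i f) (x + s *\<^sub>R axis i 1 + t *\<^sub>R axis j 1)
      = h * h * pdiff i (pdiff j f) (x + s' *\<^sub>R axis j 1 + t' *\<^sub>R axis i 1)"
      using st(5) st'(5)[unfolded comm] by linarith
    with h(1) show ?thesis by simp
  qed
  moreover have "dist (pdiff j (pdiff i f) (x + s *\<^sub>R axis i 1 + t *\<^sub>R axis j 1)) (pdiff j (pdiff i f) x) < e"
    using less_le_trans[OF n[OF st(1-4)] h(3)] by (intro d2(2)) (auto simp: dist_norm add.assoc)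
  moreover have "dist (pdiff i (pdiff j f) (x + s' *\<^sub>R axis j 1 + t' *\<^sub>R axis i 1)) (pdiff i (pdiff j f) x) < e"
    using less_le_trans[OF n[OF st'(1-4)] h(2)] by (intro d1(2)) (auto simp: dist_norm add.assoc)
  ultimately show False by (simp add: e_def dist_real_def abs_if split: if_splits)
qed

section \<open>Smooth bump functions on boxes\<close>

text \<open>The functions \<open>P (1 / t) exp (- 1 / t)\<close> are closed under differentiation, which makes each of
  them smooth by induction on the order; \<open>flat 1\<close> is the standard one-sided cut-off.\<close>

definition flat :: "real poly \<Rightarrow> real \<Rightarrow> real" where
  "flat P t = (if t > 0 then poly P (1 / t) * exp (- (1 / t)) else 0)"

lemma poly_times_exp_minus_tendsto_0: "((\<lambda>s. poly P s * exp (- s)) \<longlongrightarrow> (0::real)) at_top"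
proof -
  \<comment> \<open>The free exponent \<open>k\<close> absorbs the power of \<open>s\<close> that
    \<open>pCons\<close> splits off, so that the induction hypothesis applies with
    \<open>Suc k\<close>.\<close>
  have "((\<lambda>s. s ^ k * poly P s / exp s) \<longlongrightarrow> (0::real)) at_top" for k
  proof (induction P arbitrary: k)
    case (pCons a P)
    have "((\<lambda>s. a * (s ^ k / exp s) + s ^ Suc k * poly P s / exp s) \<longlongrightarrow> a * 0 + 0) at_top"
      by (intro tendsto_intros tendsto_power_div_exp_0 pCons.IH)
    then show ?case by (simp add: field_simps)
  qed simp
  from this[of 0] show ?thesis by (simp add: exp_minus field_simps)
qed

text \<open>Differentiating the exponential contributes P(1/t)/t^2 and differentiating the
  polynomial contributes -P'(1/t)/t^2, which explains the polynomial X^2 (P - P'). Only t = 0 needs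
  a limit argument, from each side separately.\<close>

lemma flat_has_derivative:
  "(flat P has_real_derivative flat (monom 1 2 * (P - pderiv P)) t) (at t)"
proof -
  consider "t > 0" | "t < 0" | "t = 0" by linarith
  then show ?thesis
  proof cases
    case 1
    have "((\<lambda>t. poly P (1 / t) * exp (- (1 / t))) has_real_derivative
        flat (monom 1 2 * (P - pderiv P)) t) (at t)"
      using 1 by (auto intro!: derivative_eq_intros DERIV_chain'[OF _ poly_DERIV]
          simp: flat_def poly_monom field_simps power2_eq_square)
    then show ?thesis
      by (rule has_field_derivative_transform_within_open[of _ _ _ "{0<..}"]) (use 1 in \<open>auto simp: flat_def\<close>)
  next
    case 2
    have "((\<lambda>t. 0) has_real_derivative flat (monom 1 2 * (P - pderiv P)) t) (at t)"
      using 2 by (simp add: flat_def)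
    then show ?thesis
      by (rule has_field_derivative_transform_within_open[of _ _ _ "{..<0}"]) (use 2 in \<open>auto simp: flat_def\<close>)
  next
    case 3
    \<comment> \<open>Dividing by \<open>h\<close> multiplies P(1/h) by 1/h, so the difference
      quotient at 0 is again of the same form, with X P in place of P.\<close>
    have "((\<lambda>h. poly (pCons 0 P) (inverse h) * exp (- inverse h)) \<longlongrightarrow> 0) (at_right 0)"
      by (rule filterlim_compose[OF poly_times_exp_minus_tendsto_0 filterlim_inverse_at_top_right])
    then have "((\<lambda>h. flat P h / h) \<longlongrightarrow> 0) (at_right 0)"
      by (rule Lim_transform_eventually)
        (auto simp: flat_def eventually_at_right_less field_simps intro!: eventually_at_rightI[of 0 1])
    moreover have "((\<lambda>h. flat P h / h) \<longlongrightarrow> 0) (at_left 0)"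
      by (rule Lim_transform_eventually[OF tendsto_const])
        (auto simp: flat_def intro!: eventually_at_leftI[of "-1" 0])
    ultimately have "((\<lambda>h. flat P h / h) \<longlongrightarrow> 0) (at 0)"
      by (simp add: filterlim_at_split)
    then show ?thesis
      using 3 by (simp add: has_field_derivative_iff flat_def)
  qed
qed

text \<open>The sign of \<open>c\<close> is left free so that both the cut-off at the lower face and
  the one at the upper face of a box are instances. \<open>P\<close> varies in the induction because
  differentiation changes it.\<close>

lemma Ck_flat: "Ck k (\<lambda>x. flat P (c * x $ i + d))"
proof (induction k arbitrary: P)
  case 0
  have "isCont (flat P) t" for t using flat_has_derivative DERIV_isCont by blast
  then have "continuous_on UNIV (flat P)" by (simp add: continuous_at_imp_continuous_on)
  then show ?case by (auto intro!: continuous_on_compose2[of UNIV "flat P"] continuous_intros)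
next
  case (Suc k)
  let ?Q = "monom 1 2 * (P - pderiv P)"
  have D: "((\<lambda>x. flat P (c * x $ i + d)) has_derivative (\<lambda>v. flat ?Q (c * x $ i + d) * (c * v $ i))) (at x)"
    for x :: "real^3"
    by (rule has_derivative_compose[OF _ flat_has_derivative[unfolded has_field_derivative_def]])
      (auto intro!: derivative_eq_intros bounded_linear.has_derivative[OF bounded_linear_vec_nth])
  have "pdiff j (\<lambda>x. flat P (c * x $ i + d)) = (\<lambda>x. flat ?Q (c * x $ i + d) * (c * axis j 1 $ i))" for j
    using pdiff_eqI[OF D] by blast
  then show ?case
    using D Suc by (auto intro!: Ck_mult Ck_const simp: differentiable_def)
qed

lemma Ck_prod: "(\<And>i. i \<in> I \<Longrightarrow> Ck k (f i)) \<Longrightarrow> Ck k (\<lambda>x. \<Prod>i\<in>I. f i x)"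
  by (induction I rule: infinite_finite_induct) (auto intro: Ck_const Ck_mult)

text \<open>The scale n + 1 sits inside the argument of the cut-offs: the zero set stays fixed,
  while at each point of the open box exp(-1/((n+1)s)) with s > 0 tends to 1. The limit is thus the
  indicator of the open box.\<close>

definition box_bump :: "real^3 \<Rightarrow> real^3 \<Rightarrow> nat \<Rightarrow> real^3 \<Rightarrow> real" where
  "box_bump a b n x =
     (\<Prod>i\<in>UNIV. flat 1 (real (Suc n) * (x $ i - a $ i)) * flat 1 (real (Suc n) * (b $ i - x $ i)))"

lemma smooth_box_bump: "smooth (box_bump a b n)"
proof -
  have "Ck k (\<lambda>x. flat 1 (real (Suc n) * (x $ i - a $ i)))" for k i
    using Ck_flat[of k 1 "real (Suc n)" i "- (real (Suc n) * a $ i)"] by (simp only: diff_conv_add_uminus distrib_left mult_minus_right)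
  moreover have "Ck k (\<lambda>x. flat 1 (real (Suc n) * (b $ i - x $ i)))" for k i
    using Ck_flat[of k 1 "- real (Suc n)" i "real (Suc n) * b $ i"] 
    by (simp only: diff_conv_add_uminus distrib_left mult_minus_right mult_minus_left add.commute)
  ultimately show ?thesis
    unfolding smooth_def box_bump_def by (intro allI Ck_prod Ck_mult)
qed

lemma box_bump_eq_0: "x \<notin> box a b \<Longrightarrow> box_bump a b n x = 0"
  by (auto simp: box_bump_def mem_box_cart flat_def zero_less_mult_iff)

lemma test_function_box_bump:
  assumes "cbox a b \<subseteq> U"
  shows "test_function U (box_bump a b n)"
proof -
  have "closure {x. box_bump a b n x \<noteq> 0} \<subseteq> cbox a b"
    using box_bump_eq_0 box_subset_cbox by (intro closure_minimal) blast+
  then show ?thesis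
    using assms smooth_box_bump unfolding test_function_def
    by (meson bounded_cbox bounded_subset closed_closure compact_eq_bounded_closed order_trans)
qed

lemma box_bump_bounds: "0 \<le> box_bump a b n x" "box_bump a b n x \<le> 1"
proof -
  have *: "0 \<le> flat 1 t" "flat 1 t \<le> 1" for t by (auto simp: flat_def)
  show "0 \<le> box_bump a b n x" "box_bump a b n x \<le> 1"
    unfolding box_bump_def by (intro prod_nonneg prod_le_1 conjI mult_nonneg_nonneg mult_le_one ballI *)+
qed

lemma box_bump_tendsto: "(\<lambda>n. box_bump a b n x) \<longlonglongrightarrow> indicator (box a b) x"
proof (cases "x \<in> box a b")
  case True
  have "(\<lambda>n. flat 1 (real (Suc n) * t)) \<longlonglongrightarrow> 1" if "t > 0" for t
  proof -
    have "(\<lambda>n. exp (- (inverse (real (Suc n)) * inverse t))) \<longlonglongrightarrow> exp (- (0 * inverse t))"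
      by (intro tendsto_intros LIMSEQ_inverse_real_of_nat)
    then show ?thesis using that by (simp add: flat_def field_simps zero_less_mult_iff del: of_nat_Suc)
  qed
  then have "(\<lambda>n. box_bump a b n x) \<longlonglongrightarrow> (\<Prod>i\<in>(UNIV::3 set). 1 * 1)"
    unfolding box_bump_def using True by (intro tendsto_intros) (auto simp: mem_box_cart)
  then show ?thesis using True by simp
qed (simp add: box_bump_eq_0)

section \<open>Integration by parts\<close>

lemma integrable_lborel_compact_support:
  fixes f :: "'a::euclidean_space \<Rightarrow> real"
  assumes "continuous_on UNIV f" "compact (closure {x. f x \<noteq> 0})"
  shows "integrable lborel f"
proof -
  have "integrable lborel (\<lambda>x. indicator (closure {x. f x \<noteq> 0}) x *\<^sub>R f x)"
    using assms by (intro borel_integrable_compact) (auto intro: continuous_on_subset)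
  also have "(\<lambda>x. indicator (closure {x. f x \<noteq> 0}) x *\<^sub>R f x) = f"
    using closure_subset[of "{x. f x \<noteq> 0}"] by (auto simp: indicator_def fun_eq_iff)
  finally show ?thesis .
qed

text \<open>By translation invariance the difference quotients of \<open>f\<close> have integral zero; they converge
  boundedly to the partial derivative, so no iterated integrals are needed.\<close>

lemma integral_pdiff_eq_0:
  assumes "Ck 1 f" and "compact (closure {x. f x \<noteq> 0})"
  shows "(\<integral>x. pdiff i f x \<partial>lborel) = 0"
proof -
  let ?e = "axis i 1 :: real^3"
  define t where "t n = inverse (real (Suc n))" for n
  have t: "t n > 0" "t n \<le> 1" "t \<longlonglongrightarrow> 0" for n
    unfolding t_def using LIMSEQ_inverse_real_of_nat by (auto simp: field_simps)
  have d: "f differentiable (at x)" and cont: "continuous_on UNIV f" "continuous_on UNIV (pdiff i f)" for x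
    using assms(1) Ck_continuous[OF assms(1)] by auto
  have [measurable]: "f \<in> borel_measurable borel" "pdiff i f \<in> borel_measurable borel"
    using cont by (auto intro: borel_measurable_continuous_onI)
  obtain R where R: "closure {x. f x \<noteq> 0} \<subseteq> cball 0 R"
    using compact_imp_bounded[OF assms(2)] bounded_iff[of "closure {x. f x \<noteq> 0}"]
    by (metis mem_cball_0 subsetI)
  have out: "x \<notin> closure {x. f x \<noteq> 0}" if "norm x > R" for x
    using R that by (meson mem_cball_0 not_le subsetD)
  have f0: "f x = 0" if "norm x > R" for x
    using out[OF that] closure_subset[of "{x. f x \<noteq> 0}"] by blast
  have g0: "pdiff i f x = 0" if "norm x > R" for x
    using out[OF that] by (rule pdiff_eq_0_outside_support)
  have "bounded (pdiff i f ` cball 0 R)"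
    using cont by (intro compact_imp_bounded compact_continuous_image) (auto intro: continuous_on_subset)
  then obtain M where M: "M > 0" "\<And>x. x \<in> cball 0 R \<Longrightarrow> \<bar>pdiff i f x\<bar> \<le> M"
    unfolding bounded_pos by auto
  have M': "\<bar>pdiff i f x\<bar> \<le> M" for x
    using M(2)[of x] g0[of x] M(1) by (cases "norm x \<le> R") auto
  have fi: "integrable lborel f"
    by (rule integrable_lborel_compact_support[OF cont(1) assms(2)])
  have shift: "integrable lborel (\<lambda>x. f (v + x))" "(\<integral>x. f (v + x) \<partial>lborel) = (\<integral>x. f x \<partial>lborel)" for v
    using integrable_distr[of "(+) v" lborel borel f] integral_distr[of "(+) v" lborel borel f] fi
    by (simp_all add: lborel_distr_plus)
  define q where "q n x = (f (t n *\<^sub>R ?e + x) - f x) / t n" for n x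
  have "(\<integral>x. q n x \<partial>lborel) = 0" for n
    unfolding q_def using shift[of "t n *\<^sub>R ?e"] fi by simp
  moreover have "(\<lambda>n. \<integral>x. q n x \<partial>lborel) \<longlonglongrightarrow> (\<integral>x. pdiff i f x \<partial>lborel)"
  proof (rule integral_dominated_convergence)
    \<comment> \<open>Shifts have length at most 1, so all difference quotients vanish outside the
      ball of radius \<open>R + 1\<close>; the mean value theorem bounds them by \<open>M\<close>,
      the bound for the partial derivative.\<close>
    show "integrable lborel (\<lambda>x. indicator (cball 0 (R + 1)) x *\<^sub>R M)"
      by (intro borel_integrable_compact) auto
    show "AE x in lborel. (\<lambda>n. q n x) \<longlonglongrightarrow> pdiff i f x"
    proof (rule AE_I2)
      fix x
      have "((\<lambda>h. (f (x + h *\<^sub>R ?e) - f x) / h) \<longlongrightarrow> pdiff i f x) (at 0)"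
        using has_real_derivative_along_axis[of f x 0 i] d by (simp add: has_field_derivative_iff)
      moreover have "filterlim t (at 0) sequentially"
        using t by (auto simp: filterlim_at intro!: always_eventually) (metis less_irrefl)
      ultimately show "(\<lambda>n. q n x) \<longlonglongrightarrow> pdiff i f x"
        unfolding q_def by (auto simp: add.commute dest: filterlim_compose)
    qed
    show "AE x in lborel. norm (q n x) \<le> indicator (cball 0 (R + 1)) x *\<^sub>R M" for n
    proof (rule AE_I2)
      fix x
      have "\<exists>s. 0 < s \<and> s < t n \<and> f (x + t n *\<^sub>R ?e) - f (x + 0 *\<^sub>R ?e) = (t n - 0) * pdiff i f (x + s *\<^sub>R ?e)"
        using d t by (intro MVT2 has_real_derivative_along_axis) auto
      then obtain s where s: "f (x + t n *\<^sub>R ?e) - f x = t n * pdiff i f (x + s *\<^sub>R ?e)" by auto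
      have le: "norm (q n x) \<le> M"
        using t(1)[of n] s M'[of "x + s *\<^sub>R ?e"] by (simp add: q_def add.commute)
      show "norm (q n x) \<le> indicator (cball 0 (R + 1)) x *\<^sub>R M"
      proof (cases "norm x \<le> R + 1")
        case False
        have "norm x \<le> norm (t n *\<^sub>R ?e + x) + norm (t n *\<^sub>R ?e)"
          by (metis add_diff_cancel_left' norm_triangle_sub norm_triangle_ineq4)
        then have "norm (t n *\<^sub>R ?e + x) > R" using False t(1,2)[of n] by (simp add: norm_axis_1)
        then show ?thesis using False f0 by (simp add: q_def)
      qed (use le in auto)
    qed
  qed (auto simp: q_def)
  ultimately show ?thesis by (simp add: LIMSEQ_const_iff)
qed

section \<open>Green's formula for a smooth field against a test function\<close>

lemma test_functionD:
  assumes "test_function U \<phi>"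
  shows "smooth \<phi>" "compact (closure {x. \<phi> x \<noteq> 0})" "x \<notin> U \<Longrightarrow> \<phi> x = 0"
  using assms closure_subset[of "{x. \<phi> x \<noteq> 0}"] unfolding test_function_def by auto

lemma test_function_mult:
  assumes "smooth p" "test_function U \<phi>"
  shows "test_function U (\<lambda>x. p x * \<phi> x)"
proof -
  have sub: "closure {x. p x * \<phi> x \<noteq> 0} \<subseteq> closure {x. \<phi> x \<noteq> 0}"
    by (intro closure_mono) auto
  have "bounded {x. \<phi> x \<noteq> 0}"
    using test_functionD(2)[OF assms(2)] by (simp add: compact_closure)
  then have "bounded {x. p x * \<phi> x \<noteq> 0}" by (rule bounded_subset) auto
  moreover have "smooth (\<lambda>x. p x * \<phi> x)"
    using assms test_functionD(1) by (auto simp: smooth_def intro: Ck_mult)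
  moreover have "closure {x. \<phi> x \<noteq> 0} \<subseteq> U" using assms(2) by (simp add: test_function_def)
  ultimately show ?thesis
    using sub by (simp add: test_function_def compact_closure)
qed

lemma test_function_integrable: "test_function U \<phi> \<Longrightarrow> integrable lborel \<phi>"
  by (intro integrable_lborel_compact_support smooth_continuous test_functionD)

text \<open>The product \<open>p x * \<phi> x\<close> has compact support whatever the growth of
  \<open>p\<close>, so its partial derivative integrates to zero, and the product rule splits that
  integral.\<close>

lemma integral_mult_pdiff_test_function:
  assumes "smooth p" "test_function U \<phi>"
  shows "(\<integral>x. p x * pdiff i \<phi> x \<partial>lborel) = - (\<integral>x. pdiff i p x * \<phi> x \<partial>lborel)"
proof -
  have t: "test_function U (\<lambda>x. p x * \<phi> x)" by (rule test_function_mult[OF assms])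
  have "pdiff i (\<lambda>x. p x * \<phi> x) = (\<lambda>x. p x * pdiff i \<phi> x + pdiff i p x * \<phi> x)"
    using assms test_functionD(1) by (auto simp: pdiff_mult smooth_differentiable)
  moreover have "(\<integral>x. pdiff i (\<lambda>x. p x * \<phi> x) x \<partial>lborel) = 0"
    using test_functionD[OF t] by (intro integral_pdiff_eq_0) (auto simp only: smooth_def)
  moreover have "integrable lborel (\<lambda>x. p x * pdiff i \<phi> x)" "integrable lborel (\<lambda>x. pdiff i p x * \<phi> x)"
    using assms by (auto intro!: test_function_integrable test_function_mult smooth_pdiff test_function_pdiff)
  ultimately show ?thesis by (simp add: eq_neg_iff_add_eq_0)
qed

lemma integral_inner_grad_test_function:
  assumes "smooth_field p" "test_function U \<phi>"
  shows "(\<integral>x. p x \<bullet> grad \<phi> x \<partial>lborel) = - (\<integral>x. divg p x * \<phi> x \<partial>lborel)"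
proof -
  have p: "smooth (\<lambda>x. p x $ i)" for i using assms(1) by (simp add: smooth_field_def)
  have "(\<integral>x. p x \<bullet> grad \<phi> x \<partial>lborel) = (\<Sum>i\<in>UNIV. \<integral>x. p x $ i * pdiff i \<phi> x \<partial>lborel)"
    unfolding inner_vec_def grad_def using p assms(2)
    by (subst Bochner_Integration.integral_sum[symmetric])
      (auto intro!: test_function_integrable test_function_mult test_function_pdiff)
  also have "\<dots> = - (\<Sum>i\<in>UNIV. \<integral>x. pdiff i (\<lambda>y. p y $ i) x * \<phi> x \<partial>lborel)"
    using integral_mult_pdiff_test_function[OF p assms(2)] by (simp add: sum_negf)
  also have "(\<Sum>i\<in>UNIV. \<integral>x. pdiff i (\<lambda>y. p y $ i) x * \<phi> x \<partial>lborel) = (\<integral>x. divg p x * \<phi> x \<partial>lborel)"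
    unfolding divg_def sum_distrib_right using p assms(2)
    by (subst Bochner_Integration.integral_sum[symmetric])
      (auto intro!: test_function_integrable test_function_mult smooth_pdiff)
  finally show ?thesis .
qed

section \<open>The fundamental lemma of the calculus of variations\<close>

text \<open>The Borel sets over which \<open>u\<close> integrates to zero form a Dynkin system
  containing all boxes, and an intersection of two boxes is a box. Closure under complements
  requires the total integral to vanish, which follows by exhausting the space with growing
  cubes.\<close>

lemma AE_eq_0_if_integral_box_eq_0:
  fixes u :: "'a::euclidean_space \<Rightarrow> real"
  assumes u: "integrable lborel u"
    and box0: "\<And>a b. (\<integral>x. indicator (box a b) x * u x \<partial>lborel) = 0"
  shows "AE x in lborel. u x = 0"
proof (rule density_unique_real)
  fix A :: "'a set" assume "A \<in> sets lborel"
  note [measurable] = borel_measurable_integrable[OF u]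
  have int: "integrable lborel (\<lambda>x. indicator A x * u x)" if "A \<in> sets borel" for A
    using integrable_mult_indicator[of A lborel u] u that by simp
  have tot: "(\<integral>x. u x \<partial>lborel) = 0"
  proof -
    have "(\<lambda>n. \<integral>x. indicator (box (- real n *\<^sub>R One) (real n *\<^sub>R One)) x * u x \<partial>lborel) \<longlonglongrightarrow> (\<integral>x. u x \<partial>lborel)"
    proof (rule integral_dominated_convergence[where w = "\<lambda>x. \<bar>u x\<bar>"])
      show "AE x in lborel. (\<lambda>n. indicator (box (- real n *\<^sub>R One) (real n *\<^sub>R One)) x * u x) \<longlonglongrightarrow> u x"
      proof (rule AE_I2)
        fix x :: 'a
        obtain N where N: "norm x < real N" using reals_Archimedean2 by blast
        have "x \<in> box (- real n *\<^sub>R One) (real n *\<^sub>R One)" if "n \<ge> N" for n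
        proof -
          have "\<bar>x \<bullet> i\<bar> < real n" if "i \<in> Basis" for i
            using Basis_le_norm[OF that, of x] N \<open>n \<ge> N\<close> by linarith
          then show ?thesis by (auto simp: mem_box abs_less_iff minus_less_iff)
        qed
        then show "(\<lambda>n. indicator (box (- real n *\<^sub>R One) (real n *\<^sub>R One)) x * u x) \<longlonglongrightarrow> u x"
          by (intro tendsto_eventually eventually_sequentiallyI[of N]) auto
      qed
    qed (use u in \<open>auto simp: indicator_def\<close>)
    then show ?thesis by (simp add: box0 LIMSEQ_const_iff)
  qed
  have Int: "Int_stable (range (\<lambda>(a, b). box a b :: 'a set))"
    by (auto simp: Int_stable_def box_Int_box)
  have Sub: "range (\<lambda>(a, b). box a b :: 'a set) \<subseteq> Pow UNIV" by simp
  have "A \<in> sigma_sets UNIV (range (\<lambda>(a, b). box a b))"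
    using \<open>A \<in> sets lborel\<close> by (simp add: borel_eq_box)
  with Int Sub have "(\<integral>x. indicator A x * u x \<partial>lborel) = 0"
  proof (induction rule: sigma_sets_induct_disjoint)
    case (basic A)
    then show ?case using box0 by auto
  next
    case empty
    then show ?case by simp
  next
    case (compl A)
    then have "A \<in> sets borel" by (simp add: borel_eq_box)
    have "(\<integral>x. indicator (UNIV - A) x * u x \<partial>lborel) = (\<integral>x. u x - indicator A x * u x \<partial>lborel)"
      by (intro Bochner_Integration.integral_cong) (auto simp: indicator_def)
    then show ?case using compl u int[OF \<open>A \<in> sets borel\<close>] by (simp add: tot)
  next
    case (union A)
    then have A: "A i \<in> sets borel" for i by (auto simp: borel_eq_box)
    have "(\<integral>x. indicator (\<Union>i. A i) x *\<^sub>R u x \<partial>lborel) = (\<Sum>i. (\<integral>x. indicator (A i) x *\<^sub>R u x \<partial>lborel))"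
      using lebesgue_integral_countable_add[of A lborel u] A union(1) int[of "\<Union>i. A i"]
      by (auto simp: set_lebesgue_integral_def set_integrable_def disjoint_family_on_def)
    then show ?case using union by simp
  qed
  then show "(\<integral>x\<in>A. u x \<partial>lborel) = (\<integral>x\<in>A. 0 \<partial>lborel)"
    by (simp add: set_lebesgue_integral_def)
qed (use u in auto)

text \<open>This moves integrals between a subdomain, the whole domain and the whole space when the
  integrand vanishes off the smallest of them.\<close>

lemma integral_lebesgue_on_support:
  fixes f :: "'a::euclidean_space \<Rightarrow> 'b::euclidean_space"
  assumes "S \<in> sets lebesgue" and "\<And>x. x \<notin> S \<Longrightarrow> f x = 0"
  shows "integral\<^sup>L (lebesgue_on S) f = integral\<^sup>L lebesgue f"
proof -
  have "(\<lambda>x. if x \<in> S then f x else 0) = f" using assms(2) by auto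
  then show ?thesis using Lebesgue_Measure.integral_restrict_UNIV[OF assms(1), of f] by simp
qed

text \<open>The bumps take values in [0, 1] and converge to the indicator, so \<bar>u\<bar>
  dominates. The closed box must lie in \<open>U\<close> because it contains the support of every
  bump.\<close>

lemma test_function_integral_box_eq_0:
  assumes "open U" and u: "integrable (lebesgue_on U) u"
    and test0: "\<And>\<phi>. test_function U \<phi> \<Longrightarrow> (\<integral>x. u x * \<phi> x \<partial>lebesgue_on U) = 0"
    and sub: "cbox p q \<subseteq> U"
  shows "(\<integral>x. u x * indicator (box p q) x \<partial>lebesgue_on U) = 0"
proof -
  have "(\<lambda>n. \<integral>x. u x * box_bump p q n x \<partial>lebesgue_on U)
      \<longlonglongrightarrow> (\<integral>x. u x * indicator (box p q) x \<partial>lebesgue_on U)"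
  proof (rule integral_dominated_convergence[where w = "\<lambda>x. \<bar>u x\<bar>"])
    have [measurable]: "u \<in> borel_measurable (lebesgue_on U)"
      using u by simp
    have [measurable]: "box_bump p q n \<in> borel_measurable (lebesgue_on U)" for n
      using smooth_continuous[OF smooth_box_bump] \<open>open U\<close>
      by (intro continuous_imp_measurable_on_sets_lebesgue) (auto intro: continuous_on_subset)
    have [measurable]: "(\<lambda>x. indicator (box p q) x :: real) \<in> borel_measurable (lebesgue_on U)"
      by (intro borel_measurable_indicator measurable_restrict_space1) auto
    show "(\<lambda>x. u x * indicator (box p q) x) \<in> borel_measurable (lebesgue_on U)"
      "(\<lambda>x. u x * box_bump p q n x) \<in> borel_measurable (lebesgue_on U)" for n
      by measurable
    show "AE x in lebesgue_on U. (\<lambda>n. u x * box_bump p q n x) \<longlonglongrightarrow> u x * indicator (box p q) x"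
      by (intro AE_I2 tendsto_mult_left box_bump_tendsto)
    show "AE x in lebesgue_on U. norm (u x * box_bump p q n x) \<le> \<bar>u x\<bar>" for n
      using box_bump_bounds by (intro AE_I2) (auto simp: abs_mult intro!: mult_left_le)
  qed (use u in auto)
  then show ?thesis
    by (simp add: test0[OF test_function_box_bump[OF sub]] LIMSEQ_const_iff)
qed

text \<open>Vanishing integrals are available only for boxes whose closure lies in \<open>U\<close>.
  The argument is therefore localized to one such box at a time, and countably many of them cover
  \<open>U\<close>.\<close>

lemma fundamental_lemma_calculus_of_variations:
  assumes "open U" and u: "integrable (lebesgue_on U) u"
    and test0: "\<And>\<phi>. test_function U \<phi> \<Longrightarrow> (\<integral>x. u x * \<phi> x \<partial>lebesgue_on U) = 0"
  shows "AE x in lebesgue_on U. u x = 0"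
proof -
  have U: "U \<in> sets lebesgue" using \<open>open U\<close> by auto
  let ?w = "\<lambda>x. if x \<in> U then u x else 0"
  have w: "integrable lebesgue ?w" using u Lebesgue_Measure.integrable_restrict_UNIV[OF U] by blast
  \<comment> \<open>The box criterion is stated for \<open>lborel\<close>, so \<open>u\<close>,
    extended by zero, is replaced by a Borel function equal to it almost everywhere.\<close>
  then obtain v where v[measurable]: "v \<in> borel_measurable lborel" and wv: "AE x in lborel. ?w x = v x"
    using completion_ex_borel_measurable_real[of ?w lborel] by auto
  have "integrable lebesgue v"
    by (rule integrable_cong_AE_imp[OF w measurable_completion[OF v] AE_completion[OF wv]])
  then have vi: "integrable lborel v" using integrable_completion[OF v] by simp
  have box0: "(\<integral>x. indicator (box p q) x * v x \<partial>lborel) = 0" if "cbox p q \<subseteq> U" for p q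
  proof -
    have "(\<integral>x. indicator (box p q) x * v x \<partial>lborel) = (\<integral>x. indicator (box p q) x * v x \<partial>lebesgue)"
      by (rule integral_completion[symmetric]) simp
    also have "\<dots> = (\<integral>x. ?w x * indicator (box p q) x \<partial>lebesgue)"
    proof (rule integral_cong_AE)
      show "(\<lambda>x. ?w x * indicator (box p q) x) \<in> borel_measurable lebesgue"
        by (intro borel_measurable_times borel_measurable_integrable[OF w] measurable_completion) simp
      show "(\<lambda>x. indicator (box p q) x * v x) \<in> borel_measurable lebesgue"
        by (intro measurable_completion) simp
      show "AE x in lebesgue. indicator (box p q) x * v x = ?w x * indicator (box p q) x"
        using AE_completion[OF wv] by eventually_elim simp
    qed
    also have "\<dots> = (\<integral>x. u x * indicator (box p q) x \<partial>lebesgue_on U)"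
      by (subst Lebesgue_Measure.integral_restrict_UNIV[OF U, symmetric]) (auto intro!: Bochner_Integration.integral_cong)
    also have "\<dots> = 0"
      by (rule test_function_integral_box_eq_0[OF assms that])
    finally show ?thesis .
  qed
  have AE_cbox: "AE x in lborel. x \<in> cbox c d \<longrightarrow> v x = 0" if cd: "cbox c d \<subseteq> U" for c d
  proof -
    have "AE x in lborel. indicator (box c d) x * v x = 0"
    proof (rule AE_eq_0_if_integral_box_eq_0)
      show "integrable lborel (\<lambda>x. indicator (box c d) x * v x)"
        using integrable_mult_indicator[of "box c d" lborel v] vi by simp
      fix a b
      \<comment> \<open>After cutting off to \<open>box c d\<close>, integrating over an arbitrary
        box amounts to integrating over an intersection, which is a box whose closure stays in
        \<open>cbox c d\<close> and hence in \<open>U\<close>.\<close>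
      obtain p q where pq: "box a b \<inter> box c d = box p q" "cbox a b \<inter> cbox c d = cbox p q"
        using box_Int_box Int_interval by blast
      then have "(\<integral>x. indicator (box p q) x * v x \<partial>lborel) = 0" using box0 cd by blast
      then show "(\<integral>x. indicator (box a b) x * (indicator (box c d) x * v x) \<partial>lborel) = 0"
        by (simp add: pq(1)[symmetric] indicator_inter_arith mult.assoc)
    qed
    \<comment> \<open>The cut-off controls the open box while the cover consists of closed ones; the
      difference is a null set.\<close>
    moreover have "AE x in lborel. x \<notin> cbox c d - box c d"
      using negligible_frontier_interval[of c d]
      by (intro AE_not_in) (auto simp: negligible_iff_null_sets null_sets_completion_iff)
    ultimately show ?thesis by eventually_elim (auto simp: indicator_def split: if_splits)
  qed
  obtain \<D> where \<D>: "countable \<D>" "\<D> \<subseteq> Pow U" "\<And>X. X \<in> \<D> \<Longrightarrow> \<exists>a b. X = cbox a b" "\<Union>\<D> = U"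
    using open_countable_Union_open_cbox[OF \<open>open U\<close>] by metis
  have "AE x in lborel. \<forall>X\<in>\<D>. x \<in> X \<longrightarrow> v x = 0"
    unfolding AE_ball_countable[OF \<D>(1)]
  proof
    fix X assume "X \<in> \<D>"
    then obtain c d where "X = cbox c d" "cbox c d \<subseteq> U" using \<D>(2,3) by fast
    then show "AE x in lborel. x \<in> X \<longrightarrow> v x = 0" using AE_cbox by simp
  qed
  with wv have "AE x in lborel. x \<in> U \<longrightarrow> u x = 0"
  proof eventually_elim
    case (elim x)
    then show ?case using \<D>(4) by (metis UnionE)
  qed
  then show ?thesis
    by (simp add: AE_restrict_space_iff U AE_completion)
qed

section \<open>Weak divergence and weak curl\<close>

lemma integrable_lebesgue_on_subset:
  fixes f :: "'a::euclidean_space \<Rightarrow> 'b::euclidean_space"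
  assumes "integrable (lebesgue_on S) f" "T \<subseteq> S" "S \<in> sets lebesgue" "T \<in> sets lebesgue"
  shows "integrable (lebesgue_on T) f"
  using assms set_integrable_subset[of lebesgue S f T]
  by (simp add: set_integrable_def integrable_restrict_space)

text \<open>A bounded open set has finite measure, and t \<le> 1 + t^2 supplies an integrable
  majorant.\<close>

lemma L2_imp_integrable:
  fixes u :: "real^3 \<Rightarrow> 'b::euclidean_space"
  assumes "bounded \<Omega>" "open \<Omega>" "u \<in> L2 \<Omega>"
  shows "integrable (lebesgue_on \<Omega>) u"
proof (rule Bochner_Integration.integrable_bound)
  have "\<Omega> \<in> lmeasurable" using assms by (simp add: lmeasurable_open)
  then show "integrable (lebesgue_on \<Omega>) (\<lambda>x. 1 + (norm (u x))\<^sup>2)"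
    using assms(3) finite_measure.integrable_const[OF finite_measure_lebesgue_on]
    by (auto simp: L2_def intro!: Bochner_Integration.integrable_add)
  have "norm (u x) \<le> 1 + (norm (u x))\<^sup>2" for x
  proof -
    have "2 * norm (u x) \<le> (norm (u x))\<^sup>2 + 1"
      using zero_le_power2[of "norm (u x) - 1"] by (simp add: power2_diff)
    then show ?thesis using norm_ge_zero[of "u x"] by linarith
  qed
  then show "AE x in lebesgue_on \<Omega>. norm (u x) \<le> norm (1 + (norm (u x))\<^sup>2)"
    by (intro AE_I2) (auto intro: order_trans)
qed (use assms in \<open>auto simp: L2_def\<close>)

text \<open>A test function on \<open>U\<close> is also one on \<Omega>, so \<open>d\<close> may be
  tested locally. There \<open>v\<close> can be replaced by \<open>p\<close>, and because
  \<open>p\<close> is smooth on the whole space the integration by parts takes place there, with no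
  boundary of \<open>U\<close> involved.\<close>

lemma has_weak_div_eq_divg_on:
  assumes "bounded \<Omega>" "open \<Omega>" "open U" "U \<subseteq> \<Omega>"
    and d: "has_weak_div \<Omega> v d" and p: "smooth_field p"
    and eq: "AE x in lebesgue_on U. v x = p x"
  shows "AE x in lebesgue_on U. d x = divg p x"
proof -
  have sets [simp]: "\<Omega> \<in> sets lebesgue" "U \<in> sets lebesgue" using assms by auto
  have vd: "v \<in> L2 \<Omega>" "d \<in> L2 \<Omega>" using d by (auto simp: has_weak_div_def)
  have sub: "integrable (lebesgue_on U) f" if "integrable (lebesgue_on \<Omega>) f" for f :: "_ \<Rightarrow> 'b::euclidean_space"
    using that \<open>U \<subseteq> \<Omega>\<close> sets by (rule integrable_lebesgue_on_subset)
  have di: "integrable (lebesgue_on U) d"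
    by (rule sub[OF L2_imp_integrable[OF assms(1,2) vd(2)]])
  have vm: "v \<in> borel_measurable (lebesgue_on U)"
    by (rule borel_measurable_integrable[OF sub[OF L2_imp_integrable[OF assms(1,2) vd(1)]]])
  have cm: "f \<in> borel_measurable (lebesgue_on U)" if "continuous_on UNIV f" for f :: "_ \<Rightarrow> 'b::euclidean_space"
    using that \<open>open U\<close>
    by (intro continuous_imp_measurable_on_sets_lebesgue) (auto intro: continuous_on_subset)
  have cdiv: "continuous_on UNIV (divg p)"
    using p unfolding divg_def smooth_field_def
    by (intro continuous_on_sum smooth_continuous smooth_pdiff) auto
  have cp: "continuous_on UNIV p"
    using p smooth_continuous unfolding smooth_field_def
    by (subst continuous_on_componentwise) (auto simp: Basis_vec_def inner_axis)
  have divi: "integrable (lebesgue_on U) (divg p)"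
  proof -
    have "compact (closure U)" using \<open>bounded \<Omega>\<close> \<open>U \<subseteq> \<Omega>\<close> bounded_subset by auto
    then have "integrable lborel (\<lambda>x. indicator (closure U) x *\<^sub>R divg p x)"
      using cdiv by (intro borel_integrable_compact) (auto intro: continuous_on_subset)
    then have "integrable (lebesgue_on (closure U)) (divg p)"
      by (simp add: integrable_restrict_space integrable_completion)
    then show ?thesis
      by (rule integrable_lebesgue_on_subset) (auto simp: closure_subset)
  qed
  have "AE x in lebesgue_on U. d x - divg p x = 0"
  proof (rule fundamental_lemma_calculus_of_variations[OF \<open>open U\<close>])
    show "integrable (lebesgue_on U) (\<lambda>x. d x - divg p x)" using di divi by simp
    fix \<phi> assume \<phi>: "test_function U \<phi>"
    note \<phi>D = test_functionD[OF \<phi>]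
    have c\<phi>: "continuous_on UNIV \<phi>" using \<phi>D(1) smooth_continuous by blast
    have cg: "continuous_on UNIV (grad \<phi>)"
      using smooth_continuous[OF smooth_pdiff[OF \<phi>D(1)]]
      by (subst continuous_on_componentwise) (auto simp: Basis_vec_def inner_axis grad_def)
    note [measurable] = cp[THEN borel_measurable_continuous_onI] cg[THEN borel_measurable_continuous_onI]
      c\<phi>[THEN borel_measurable_continuous_onI] cdiv[THEN borel_measurable_continuous_onI]
    have g0: "grad \<phi> x = 0" if "x \<notin> U" for x
      using test_functionD(3)[OF test_function_pdiff[OF \<phi>] that] by (simp add: grad_def vec_eq_iff)
    have "bounded (range \<phi>)"
    proof -
      have "bounded (\<phi> ` closure {x. \<phi> x \<noteq> 0})"
        using \<phi>D(2) c\<phi> by (intro compact_imp_bounded compact_continuous_image) (auto intro: continuous_on_subset)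
      then have "bounded (insert 0 (\<phi> ` closure {x. \<phi> x \<noteq> 0}))" by simp
      moreover have "range \<phi> \<subseteq> insert 0 (\<phi> ` closure {x. \<phi> x \<noteq> 0})"
        using closure_subset[of "{x. \<phi> x \<noteq> 0}"] by auto
      ultimately show ?thesis using bounded_subset by blast
    qed
    \<comment> \<open>Boundedness of \<open>\<phi>\<close> makes both products integrable, which is
      what allows the final difference to be split into two integrals.\<close>
    then have mi: "integrable (lebesgue_on U) (\<lambda>x. f x * \<phi> x)" if "integrable (lebesgue_on U) f" for f
    proof -
      obtain M where M: "\<And>x. \<bar>\<phi> x\<bar> \<le> M"
        using \<open>bounded (range \<phi>)\<close> unfolding bounded_iff by auto
      show ?thesis
      proof (rule Bochner_Integration.integrable_bound)
        show "integrable (lebesgue_on U) (\<lambda>x. \<bar>f x\<bar> * M)" using that by simp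
        show "AE x in lebesgue_on U. norm (f x * \<phi> x) \<le> norm (\<bar>f x\<bar> * M)"
          using M abs_ge_self[of M] by (intro AE_I2) (auto simp: abs_mult intro!: mult_left_mono order_trans[OF M])
      qed (use that cm[OF c\<phi>] in auto)
    qed
    have "(\<integral>x. d x * \<phi> x \<partial>lebesgue_on U) = (\<integral>x. d x * \<phi> x \<partial>lebesgue_on \<Omega>)"
      using \<phi>D(3) \<open>U \<subseteq> \<Omega>\<close> by (subst (1 2) integral_lebesgue_on_support) auto
    also have "\<dots> = - (\<integral>x. v x \<bullet> grad \<phi> x \<partial>lebesgue_on \<Omega>)"
      using d test_function_mono[OF \<phi> \<open>U \<subseteq> \<Omega>\<close>] by (auto simp: has_weak_div_def L2_inner_def)
    also have "(\<integral>x. v x \<bullet> grad \<phi> x \<partial>lebesgue_on \<Omega>) = (\<integral>x. v x \<bullet> grad \<phi> x \<partial>lebesgue_on U)"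
      using g0 subsetD[OF \<open>U \<subseteq> \<Omega>\<close>] by (subst (1 2) integral_lebesgue_on_support) (auto, metis inner_zero_right)
    also have "\<dots> = (\<integral>x. p x \<bullet> grad \<phi> x \<partial>lebesgue_on U)"
      using vm cm[OF cp] cm[OF cg] eq by (intro integral_cong_AE) auto
    also have "\<dots> = (\<integral>x. p x \<bullet> grad \<phi> x \<partial>lebesgue)"
      using g0 by (intro integral_lebesgue_on_support) auto
    also have "\<dots> = (\<integral>x. p x \<bullet> grad \<phi> x \<partial>lborel)"
      by (intro integral_completion) simp
    also have "\<dots> = - (\<integral>x. divg p x * \<phi> x \<partial>lborel)"
      by (rule integral_inner_grad_test_function[OF p \<phi>])
    also have "(\<integral>x. divg p x * \<phi> x \<partial>lborel) = (\<integral>x. divg p x * \<phi> x \<partial>lebesgue)"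
      by (intro integral_completion[symmetric]) simp
    also have "\<dots> = (\<integral>x. divg p x * \<phi> x \<partial>lebesgue_on U)"
      using \<phi>D(3) by (intro integral_lebesgue_on_support[symmetric]) auto
    finally show "(\<integral>x. (d x - divg p x) * \<phi> x \<partial>lebesgue_on U) = 0"
      using mi[OF di] mi[OF divi] by (simp add: left_diff_distrib)
  qed
  then show ?thesis by simp
qed

lemma has_weak_div_zero_unique:
  assumes "bounded \<Omega>" "open \<Omega>" "has_weak_div \<Omega> v (\<lambda>x. 0)" "has_weak_div \<Omega> v d"
  shows "AE x in lebesgue_on \<Omega>. d x = 0"
proof (rule fundamental_lemma_calculus_of_variations)
  fix \<phi> assume \<phi>: "test_function \<Omega> \<phi>"
  have "- L2_inner \<Omega> d \<phi> = - L2_inner \<Omega> (\<lambda>x. 0) \<phi>"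
    using \<phi> assms(3,4) unfolding has_weak_div_def by metis
  then show "(\<integral>x. d x * \<phi> x \<partial>lebesgue_on \<Omega>) = 0" by (simp add: L2_inner_def)
qed (use assms L2_imp_integrable in \<open>auto simp: has_weak_div_def\<close>)

lemma curl_grad:
  assumes "Ck 2 \<phi>"
  shows "curl (grad \<phi>) x = 0"
  using pdiff_commute[OF assms] by (simp add: curl_def grad_def vec_eq_iff forall_3)

text \<open>The gradient of a scalar test function is itself a test field, so it may be inserted
  into the defining identity of the weak curl.\<close>

lemma has_weak_div_weak_curl:
  assumes "has_weak_curl \<Omega> v c"
  shows "has_weak_div \<Omega> c (\<lambda>x. 0)"
  unfolding has_weak_div_def
proof (intro conjI allI impI)
  fix \<phi> assume \<phi>: "test_function \<Omega> \<phi>"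
  then have "test_field \<Omega> (grad \<phi>)"
    by (auto simp: test_field_def grad_def test_function_pdiff)
  then have "L2_inner \<Omega> c (grad \<phi>) = L2_inner \<Omega> v (curl (grad \<phi>))"
    using assms by (auto simp: has_weak_curl_def)
  also have "curl (grad \<phi>) = (\<lambda>x. 0)"
    using curl_grad test_functionD(1)[OF \<phi>] by (auto simp: smooth_def)
  finally show "L2_inner \<Omega> c (grad \<phi>) = - L2_inner \<Omega> (\<lambda>x. 0) \<phi>"
    by (simp add: L2_inner_def)
qed (use assms in \<open>auto simp: has_weak_curl_def L2_def\<close>)

section \<open>Piecewise affine fields on triangulations\<close>

text \<open>Without this, a simplex of the triangulation could meet the complement of \<open>\<Omega>\<close> in positive
  measure, where the chosen representative of a weak divergence is arbitrary.\<close>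

lemma interior_closure_subset_if_lipschitz_boundary:
  assumes "open \<Omega>" "lipschitz_boundary \<Omega>"
  shows "interior (closure \<Omega>) \<subseteq> \<Omega>"
proof
  fix p assume p: "p \<in> interior (closure \<Omega>)"
  show "p \<in> \<Omega>"
  proof (rule ccontr)
    assume "p \<notin> \<Omega>"
    then have "p \<in> frontier \<Omega>"
      using p interior_subset \<open>open \<Omega>\<close> by (auto simp: frontier_def interior_open)
    then obtain T :: "real^3 \<Rightarrow> real^3" and r L
      and \<gamma> :: "real^2 \<Rightarrow> real" where T: "orthogonal_transformation T" and "r > 0"
      and lip: "L-lipschitz_on UNIV \<gamma>"
      and epi: "\<And>y. y \<in> ball p r \<Longrightarrow> y \<in> \<Omega> \<longleftrightarrow> \<gamma> (vector [T y $ 1, T y $ 2]) < T y $ 3"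
      using assms(2) unfolding lipschitz_boundary_def by meson
    \<comment> \<open>\<open>h\<close> is the height of the graph above the point: it is positive
      strictly below the graph and nonnegative at \<open>p\<close>, which is not in
      \<Omega>.\<close>
    define h where "h y = \<gamma> (vector [T y $ 1, T y $ 2]) - T y $ 3" for y
    have lin: "linear T" using T by (simp add: orthogonal_transformation_def)
    then have cT: "continuous_on UNIV T" by (simp add: linear_continuous_on linear_conv_bounded_linear)
    have vec: "(\<lambda>y. vector [T y $ 1, T y $ 2] :: real^2) = (\<lambda>y. (T y $ 1) *\<^sub>R axis 1 1 + (T y $ 2) *\<^sub>R axis 2 1)"
      by (auto simp: fun_eq_iff vec_eq_iff forall_2 axis_def)
    have "continuous_on UNIV (\<lambda>y. vector [T y $ 1, T y $ 2] :: real^2)"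
      unfolding vec using cT by (intro continuous_intros)
    with cT lipschitz_on_continuous_on[OF lip] have ch: "continuous_on UNIV h"
      unfolding h_def
      by (auto intro!: continuous_intros continuous_on_compose2[of UNIV \<gamma>])
    obtain e where e: "T e = axis 3 1"
      using T orthogonal_transformation_surj by (metis surjD)
    have ne: "norm e = 1"
      using e orthogonal_transformation_norm[OF T, of e] by (simp add: norm_axis_1)
    obtain s where s: "s > 0" "ball p s \<subseteq> interior (closure \<Omega>)"
      using p open_interior open_contains_ball by blast
    define t where "t = min r s / 2"
    have t: "t > 0" "t < r" "t < s" using \<open>r > 0\<close> s by (auto simp: t_def)
    \<comment> \<open>Moving against \<open>e\<close> goes straight down in the local coordinates,
      keeping the first two fixed. Thus \<open>q\<close> is strictly below the graph, yet close
      enough to \<open>p\<close> to remain in the interior of the closure.\<close>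
    define q where "q = p - t *\<^sub>R e"
    have q: "q \<in> ball p r" "q \<in> ball p s" using t ne by (auto simp: q_def dist_norm)
    have "T q = T p - t *\<^sub>R axis 3 1"
      using lin by (simp add: q_def linear_diff linear_scale e)
    then have "T q $ 1 = T p $ 1" "T q $ 2 = T p $ 2" "T q $ 3 = T p $ 3 - t"
      by (auto simp: axis_def)
    moreover have "h p \<ge> 0" using epi[of p] \<open>p \<notin> \<Omega>\<close> \<open>r > 0\<close> by (simp add: h_def)
    ultimately have "h q > 0" using t by (simp add: h_def)
    \<comment> \<open>An open set disjoint from \<Omega> is disjoint from its closure, but this one
      contains \<open>q\<close>.\<close>
    have "open (ball p r \<inter> {y. 0 < h y})"
      using ch by (intro open_Int open_Collect_less) (auto intro: continuous_intros)
    moreover have "(ball p r \<inter> {y. 0 < h y}) \<inter> \<Omega> = {}"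
      using epi by (auto simp: h_def)
    ultimately have "(ball p r \<inter> {y. 0 < h y}) \<inter> closure \<Omega> = {}"
      using open_Int_closure_eq_empty by blast
    then show False using q \<open>h q > 0\<close> s(2) interior_subset by blast
  qed
qed

section \<open>Polynomials of degree at most one as smooth functions\<close>

lemma Ck_coordinate: "Ck k (\<lambda>x. x $ i)"
proof (cases k)
  case (Suc m)
  have D: "((\<lambda>x. x $ i) has_derivative (\<lambda>v. v $ i)) (at x)" for x :: "real^3"
    by (rule bounded_linear_imp_has_derivative[OF bounded_linear_vec_nth])
  have "pdiff j (\<lambda>x. x $ i) = (\<lambda>x. axis j 1 $ i)" for j
    using pdiff_eqI[OF D] by blast
  then show ?thesis using D Suc by (auto simp: differentiable_def Ck_const)
qed (auto intro: continuous_intros)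

text \<open>This turns the multi-index sum in \<open>poly_deg_le\<close> into one constant and three
  linear terms.\<close>

lemma multiindices_le_1: "{\<alpha> :: nat^3. (\<Sum>i\<in>UNIV. \<alpha> $ i) \<le> 1} = insert 0 (range (\<lambda>i. axis i 1))"
proof (intro set_eqI iffI)
  fix \<alpha> :: "nat^3"
  assume "\<alpha> \<in> {\<alpha>. (\<Sum>i\<in>UNIV. \<alpha> $ i) \<le> 1}"
  then consider "(\<Sum>i\<in>UNIV. \<alpha> $ i) = 0" | "(\<Sum>i\<in>UNIV. \<alpha> $ i) = 1" by fastforce
  then show "\<alpha> \<in> insert 0 (range (\<lambda>i. axis i 1))"
  proof cases
    case 1
    then show ?thesis by (auto simp: vec_eq_iff)
  next
    case 2
    then obtain i where "\<alpha> $ i = 1" "\<forall>j. i \<noteq> j \<longrightarrow> \<alpha> $ j = 0"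
      by (subst (asm) sum_eq_1_iff) auto
    then have "\<alpha> = axis i 1" by (auto simp: vec_eq_iff axis_def)
    then show ?thesis by blast
  qed
qed (auto simp: axis_def sum.delta')

lemma poly_deg_le_1E:
  assumes "poly_deg_le 1 p"
  obtains b m where "p = (\<lambda>x. b + (\<Sum>i\<in>UNIV. m i * x $ i))"
proof -
  obtain c :: "nat^3 \<Rightarrow> real" where p: "p = (\<lambda>x. \<Sum>\<alpha>\<in>{\<alpha>. (\<Sum>i\<in>UNIV. \<alpha> $ i) \<le> 1}. c \<alpha> * (\<Prod>i\<in>UNIV. x $ i ^ (\<alpha> $ i)))"
    using assms unfolding poly_deg_le_def by blast
  have "inj (\<lambda>i::3. axis i (1::nat))" by (auto simp: inj_def axis_eq_axis)
  moreover have "0 \<notin> range (\<lambda>i::3. axis i (1::nat))"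
    by (auto simp: eq_commute[of 0])
  moreover have "(\<Prod>j\<in>UNIV. x $ j ^ (axis i 1 $ j)) = x $ i" for x :: "real^3" and i
  proof -
    have "(\<Prod>j\<in>UNIV. x $ j ^ (axis i 1 $ j)) = (\<Prod>j\<in>UNIV. if j = i then x $ j else 1)"
      by (intro prod.cong) (auto simp: axis_def)
    then show ?thesis by simp
  qed
  ultimately have "p = (\<lambda>x. c 0 + (\<Sum>i\<in>UNIV. c (axis i 1) * x $ i))"
    unfolding p multiindices_le_1 by (subst sum.insert) (auto simp: sum.reindex)
  then show thesis by (rule that)
qed

lemma affine_smooth: "smooth (\<lambda>x. b + (\<Sum>i\<in>UNIV. m i * x $ i))"
  unfolding smooth_def sum_3 by (intro allI Ck_add Ck_mult Ck_const Ck_coordinate)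

lemma pdiff_affine: "pdiff j (\<lambda>x. b + (\<Sum>i\<in>UNIV. m i * x $ i)) x = m j"
proof -
  have "((\<lambda>x::real^3. b + (\<Sum>i\<in>UNIV. m i * x $ i)) has_derivative (\<lambda>v. \<Sum>i\<in>UNIV. m i * v $ i)) (at x)"
    by (auto intro!: derivative_eq_intros bounded_linear_imp_has_derivative[OF bounded_linear_vec_nth])
  from pdiff_eqI[OF this] show ?thesis
    by (simp add: axis_def if_distrib[of "\<lambda>t. _ * t"] sum.delta cong: if_cong)
qed

lemma poly_deg_le_0_const: "poly_deg_le 0 (\<lambda>x. c)"
proof -
  have "{\<alpha> :: nat^3. (\<Sum>i\<in>UNIV. \<alpha> $ i) \<le> 0} = {0}" by (auto simp: vec_eq_iff)
  then show ?thesis unfolding poly_deg_le_def by (intro exI[of _ "\<lambda>_. c"]) simp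
qed

text \<open>This is the local content of the inclusion div D_h \<subseteq> S_h: the trace of the
  linear part of \<open>v\<close> is the constant value of \<open>d\<close>.\<close>

lemma weak_div_const_on_simplex:
  assumes "bounded \<Omega>" "open \<Omega>" "lipschitz_boundary \<Omega>"
    and K: "3 simplex K" "K \<subseteq> closure \<Omega>"
    and d: "has_weak_div \<Omega> v d" and v: "v \<in> P_vec_on 1 K"
  shows "d \<in> P_on 0 K"
proof -
  have "K \<in> sets lebesgue" using closed_simplex[OF K(1)] by auto
  have "interior K \<subseteq> \<Omega>"
    using interior_closure_subset_if_lipschitz_boundary[OF assms(2,3)] interior_mono[OF K(2)] by blast
  have "\<exists>b m. AE x in lebesgue_on K. v x $ i = b + (\<Sum>j\<in>UNIV. m j * x $ j)" for i
  proof -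
    obtain p where "poly_deg_le 1 p" "AE x in lebesgue_on K. v x $ i = p x"
      using v by (auto simp: P_vec_on_def P_on_def)
    moreover from this(1) obtain b m where "p = (\<lambda>x. b + (\<Sum>j\<in>UNIV. m j * x $ j))"
      by (rule poly_deg_le_1E)
    ultimately show ?thesis by blast
  qed
  then obtain b where "\<forall>i. \<exists>m. AE x in lebesgue_on K. v x $ i = b i + (\<Sum>j\<in>UNIV. m j * x $ j)"
    using choice[of "\<lambda>i b. \<exists>m. AE x in lebesgue_on K. v x $ i = b + (\<Sum>j\<in>UNIV. m j * x $ j)"] by blast
  from choice[OF this]
  obtain m where bm: "\<And>i. AE x in lebesgue_on K. v x $ i = b i + (\<Sum>j\<in>UNIV. m i j * x $ j)"
    by blast
  \<comment> \<open>The affine formulas, valid almost everywhere on \<open>K\<close>, define a field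
    on the whole space, as the comparison with the classical divergence requires.\<close>
  define p where "p x = (\<chi> i. b i + (\<Sum>j\<in>UNIV. m i j * x $ j))" for x
  have "AE x in lebesgue_on K. \<forall>i. v x $ i = b i + (\<Sum>j\<in>UNIV. m i j * x $ j)"
    using bm by (subst AE_all_countable) auto
  then have "AE x in lebesgue. x \<in> K \<longrightarrow> v x = p x"
    using \<open>K \<in> sets lebesgue\<close> by (simp add: AE_restrict_space_iff p_def vec_eq_iff)
  then have "AE x in lebesgue_on (interior K). v x = p x"
    using interior_subset[of K] by (subst AE_restrict_space_iff) (auto elim!: eventually_mono)
  moreover have "smooth_field p"
    by (simp add: smooth_field_def p_def affine_smooth)
  ultimately have "AE x in lebesgue_on (interior K). d x = divg p x"
    using \<open>interior K \<subseteq> \<Omega>\<close> assms(1,2) d by (intro has_weak_div_eq_divg_on) auto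
  moreover have "divg p x = (\<Sum>i\<in>UNIV. m i i)" for x
    by (simp add: divg_def p_def pdiff_affine)
  ultimately have "AE x in lebesgue. x \<in> interior K \<longrightarrow> d x = (\<Sum>i\<in>UNIV. m i i)"
    by (simp add: AE_restrict_space_iff)
  \<comment> \<open>The identity is known only on the open interior, where test functions can live;
    a convex set has a negligible frontier, so it extends to \<open>K\<close>.\<close>
  moreover have "AE x in lebesgue. x \<notin> frontier K"
    using negligible_convex_frontier[OF convex_simplex[OF K(1)]]
    by (intro AE_not_in) (simp add: negligible_iff_null_sets)
  ultimately have "AE x in lebesgue. x \<in> K \<longrightarrow> d x = (\<Sum>i\<in>UNIV. m i i)"
    by eventually_elim (use closure_subset[of K] in \<open>auto simp: frontier_def\<close>)
  then have "AE x in lebesgue_on K. d x = (\<Sum>i\<in>UNIV. m i i)"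
    using \<open>K \<in> sets lebesgue\<close> by (simp add: AE_restrict_space_iff)
  then show ?thesis
    unfolding P_on_def using poly_deg_le_0_const by blast
qed

lemma L2_inner_self_eq_0:
  assumes "u \<in> L2 \<Omega>" "L2_inner \<Omega> u u = 0"
  shows "AE x in lebesgue_on \<Omega>. u x = 0"
  using assms integral_nonneg_eq_0_iff_AE[of "lebesgue_on \<Omega>" "\<lambda>x. (norm (u x))\<^sup>2"]
  by (simp add: L2_def L2_inner_def dot_square_norm)

theorem mainTheorem1:
  fixes \<Omega> :: "(real^3) set" and \<T> :: "(real^3) set set"
    and \<kappa> \<sigma> Rm \<eta> \<nu>\<^sub>m :: real
    and w f g J A B :: "real^3 \<Rightarrow> real^3" and \<phi> r :: "real^3 \<Rightarrow> real"
  assumes "bounded \<Omega>" and "simply_connected \<Omega>" and "lipschitz_polyhedral_domain \<Omega>"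
    and "tetrahedral_triangulation \<T> \<Omega>" and "shape_regular \<kappa> \<T>"
    and "\<sigma> > 0" and "\<eta> = inverse \<sigma>" and "Rm > 0" and "\<nu>\<^sub>m = inverse Rm"
    and "w \<in> L2 \<Omega>" and "f \<in> L2 \<Omega>" and "g \<in> L2 \<Omega>"
    and "J \<in> D_space \<Omega> \<T>" and "\<phi> \<in> S_space \<Omega> \<T>" and "A \<in> C_space \<Omega> \<T>" and "r \<in> R_space \<Omega> \<T>"
    and "\<And>\<phi>\<^sub>h \<psi>\<^sub>h a\<^sub>h s\<^sub>h.
           \<phi>\<^sub>h \<in> D_space \<Omega> \<T> \<Longrightarrow> \<psi>\<^sub>h \<in> S_space \<Omega> \<T> \<Longrightarrow> a\<^sub>h \<in> C_space \<Omega> \<T> \<Longrightarrow> s\<^sub>h \<in> R_space \<Omega> \<T> \<Longrightarrow>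
           \<eta> * L2_inner \<Omega> J \<phi>\<^sub>h - L2_inner \<Omega> \<phi> (weak_div \<Omega> \<phi>\<^sub>h)
               - L2_inner \<Omega> (\<lambda>x. w x \<times> weak_curl \<Omega> A x) \<phi>\<^sub>h = L2_inner \<Omega> f \<phi>\<^sub>h \<and>
           - L2_inner \<Omega> (weak_div \<Omega> J) \<psi>\<^sub>h = 0 \<and>
           - L2_inner \<Omega> J a\<^sub>h + \<nu>\<^sub>m * L2_inner \<Omega> (weak_curl \<Omega> A) (weak_curl \<Omega> a\<^sub>h)
               + L2_inner \<Omega> (weak_grad \<Omega> r) a\<^sub>h = L2_inner \<Omega> g a\<^sub>h \<and>
           L2_inner \<Omega> A (weak_grad \<Omega> s\<^sub>h) = 0"
    and "B = weak_curl \<Omega> A"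
  shows "J \<in> Hdiv \<Omega> \<and> (AE x in lebesgue_on \<Omega>. weak_div \<Omega> J x = 0) \<and>
         B \<in> Hdiv \<Omega> \<and> (AE x in lebesgue_on \<Omega>. weak_div \<Omega> B x = 0)"
proof -
  have \<Omega>: "open \<Omega>" "lipschitz_boundary \<Omega>"
    using assms(3) by (auto simp: lipschitz_polyhedral_domain_def)
  have J: "J \<in> Hdiv \<Omega>" "\<And>K. K \<in> \<T> \<Longrightarrow> J \<in> P_vec_on 1 K"
    using assms(13) by (auto simp: D_space_def)
  have dJ: "has_weak_div \<Omega> J (weak_div \<Omega> J)"
    using J(1) someI_ex[of "has_weak_div \<Omega> J"] by (simp add: Hdiv_def weak_div_def)
  then have dJ2: "weak_div \<Omega> J \<in> L2 \<Omega>" by (simp add: has_weak_div_def)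
  have "weak_div \<Omega> J \<in> P_on 0 K" if "K \<in> \<T>" for K
    using assms(4) that J(2)
    by (intro weak_div_const_on_simplex[OF assms(1) \<Omega> _ _ dJ]) (auto simp: tetrahedral_triangulation_def)
  with dJ2 have "weak_div \<Omega> J \<in> S_space \<Omega> \<T>" by (simp add: S_space_def)
  \<comment> \<open>The discrete equations are given for whole quadruples of test functions. The
    slot of \<open>S_space\<close> receives \<open>weak_div \<Omega> J\<close>, and the other three
    are filled by the discrete solution itself: \<open>J\<close>, \<open>A\<close> and
    \<open>r\<close>.\<close>
  with assms(13-17) have "- L2_inner \<Omega> (weak_div \<Omega> J) (weak_div \<Omega> J) = 0" by blast
  then have divJ: "AE x in lebesgue_on \<Omega>. weak_div \<Omega> J x = 0"
    using dJ2 by (intro L2_inner_self_eq_0) simp_all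
  have "A \<in> Hcurl \<Omega>" using assms(15) by (simp add: C_space_def Hcurl_0_def)
  then have "has_weak_curl \<Omega> A B"
    using someI_ex[of "has_weak_curl \<Omega> A"] by (simp add: assms(18) Hcurl_def weak_curl_def)
  then have B0: "has_weak_div \<Omega> B (\<lambda>x. 0)" by (rule has_weak_div_weak_curl)
  then have "B \<in> Hdiv \<Omega>" by (auto simp: Hdiv_def)
  \<comment> \<open>The chosen representative need not be the zero function; it is only some weak
    divergence of \<open>B\<close>, so uniqueness has to compare it with zero.\<close>
  have "has_weak_div \<Omega> B (weak_div \<Omega> B)"
    unfolding weak_div_def using B0 by (rule someI[of "has_weak_div \<Omega> B"])
  then have "AE x in lebesgue_on \<Omega>. weak_div \<Omega> B x = 0"
    by (rule has_weak_div_zero_unique[OF assms(1) \<Omega>(1) B0])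
  with J(1) divJ \<open>B \<in> Hdiv \<Omega>\<close> show ?thesis by blast
qed

end
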